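(* For all $m,n\in\mathbb{Z}_{\ge0}$ the following identities hold in the quantum cluster algebra $\mathcal{A}_q(Q)$ of type $A_2^{(1)}$ with principal coefficients (empty sums are $0$). (1) When $m$ is odd: (i) in each of the three cases below, $X_{-m}X_{-m+2n+3}=P\,X_{-m+n+1}X_{-m+n+2}+\sum_{l=0}^{\lfloor n/2\rfloor}\Big(\sum_{i=0}^{l}q^{\frac{2i+3l}{2}}\Big)u_{n-2l}(y_1y_2y_3)^l+y_2\sum_{l=0}^{\lfloor (n-1)/2\rfloor}\Big(\sum_{i=0}^{l}q^{\frac{2i+1+3l}{2}}\Big)u_{n-1-2l}(y_1y_2y_3)^l$, where - for $\frac{m-1}{2}\le n\le m-2$: $P=q^{\frac{14n-5m+9}{4}}y_1y_2(y_1y_2y_3)^{\frac{2n-m+1}{2}}$; - for $n=m-1$: $P=q^{\frac{5m-3}{4}}y_2(y_1y_2y_3)^{\frac{m-1}{2}}$; - for $n\ge m$: $P=q^{\frac{m+3}{4}}y_2y_3(y_1y_2y_3)^{\frac{m-1}{2}}$; (ii) in each of the three cases below, $X_{-m}X_{-m+2n}=P\,X_{-m+2\lfloor n/2\rfloor}X_{-m+2\lceil n/2\rceil}+w\sum_{l=0}^{\lfloor (n-2)/2\rfloor}\Big(\sum_{i=0}^{l}q^{\frac{2i+3l}{2}}\Big)u_{n-2-2l}(y_1y_2y_3)^l$, where - for $\frac{m+1}{2}\le n\le m-1$: $P=q^{\frac{14n-5m-11}{4}}y_1(y_1y_2y_3)^{\frac{2n-m-1}{2}}$; - for $n=m$: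 $P=q^{\frac{5m-5}{4}}(y_1y_2y_3)^{\frac{m-1}{2}}$; - for $n\ge m+1$: $P=q^{\frac{m+3}{4}}y_2y_3(y_1y_2y_3)^{\frac{m-1}{2}}$. (2) When $m$ is even: (i) in each of the three cases below, $X_{-m}X_{-m+2n+3}=P\,X_{-m+n+1}X_{-m+n+2}+\sum_{l=0}^{\lfloor n/2\rfloor}\Big(\sum_{i=0}^{l}q^{\frac{2i+3l}{2}}\Big)u_{n-2l}(y_1y_2y_3)^l+y_1y_3\sum_{l=0}^{\lfloor (n-1)/2\rfloor}\Big(\sum_{i=0}^{l}q^{\frac{2i+2+3l}{2}}\Big)u_{n-1-2l}(y_1y_2y_3)^l$, where - for $\frac{m-2}{2}\le n\le m-2$: $P=q^{\frac{14n-5m+12}{4}}y_1(y_1y_2y_3)^{\frac{2n-m+2}{2}}$; - for $n=m-1$: $P=q^{\frac{5m}{4}}(y_1y_2y_3)^{\frac m2}$; - for $n\ge m$: $P=q^{\frac{m+2}{4}}y_3(y_1y_2y_3)^{\frac m2}$; (ii) in each of the three cases below, $X_{-m}X_{-m+2n}=P\,X_{-m+2\lfloor n/2\rfloor}X_{-m+2\lceil n/2\rceil}+z\sum_{l=0}^{\lfloor (n-2)/2\rfloor}\Big(\sum_{i=0}^{l}q^{\frac{2i+3l}{2}}\Big)u_{n-2-2l}(y_1y_2y_3)^l$, where - for $\frac{m+2}{2}\le n\le m$: $P=q^{\frac{14n-5m-14}{4}}y_1y_2(y_1y_2y_3)^{\frac{2n-m-2}{2}}$; - for $n=m+1$: $P=q^{\frac{5m}{4}}(y_1y_2y_3)^{\frac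 m2}$; - for $n\ge m+2$: $P=q^{\frac{m+2}{4}}y_3(y_1y_2y_3)^{\frac m2}$.
   Context: Quantum torus. Let $q$ be a formal parameter and let $\Lambda$ be the skew-symmetric bilinear form on $\mathbb{Z}^6$ (standard basis $\mathbf e_1,\dots,\mathbf e_6$) with $\Lambda(\mathbf e_i,\mathbf e_j)=\lambda_{ij}$, where $$(\lambda_{ij})=\begin{pmatrix}0&0&0&-1&0&0\\0&0&0&0&-1&0\\0&0&0&0&0&-1\\1&0&0&0&-1&-1\\0&1&0&1&0&-1\\0&0&1&1&1&0\end{pmatrix},\qquad \widetilde B=\begin{pmatrix}0&1&1\\-1&0&1\\-1&-1&0\\1&0&0\\0&1&0\\0&0&1\end{pmatrix}.$$ The based quantum torus $\mathcal T$ is the $\mathbb{Z}[q^{\pm 1/2}]$-algebra with $\mathbb{Z}[q^{\pm 1/2}]$-basis $\{X^{\mathbf c}:\mathbf c\in\mathbb{Z}^6\}$ and multiplication $X^{\mathbf c}X^{\mathbf d}=q^{\Lambda(\mathbf c,\mathbf d)/2}X^{\mathbf c+\mathbf d}$; $\mathcal F$ is its skew-field of fractions. Put $X_i=X^{\mathbf e_i}$ for $i=1,2,3$ and $y_1=X^{\mathbf e_4}$, $y_2=X^{\mathbf e_5}$, $y_3=X^{\mathbf e_6}$ (these do not commute; products are ordered as written). Seeds and mutation. A quantum seed is a triple $(\Lambda',\widetilde B',X')$ with $X'=(X_1',\dots,X_6')$ in $\mathcal F$, where $(X')^{\mathbf c}:=q^{-\frac12\sum_{i<j}c_ic_j\lambda'_{ij}}(X_1')^{c_1}\cdots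 (X_6')^{c_6}$. The mutation in direction $k\in\{1,2,3\}$ replaces $\Lambda'$ by $E^T\Lambda' E$, where $E=(e_{ij})$ has $e_{ij}=\delta_{ij}$ for $j\ne k$, $e_{kk}=-1$, $e_{ik}=[-b'_{ik}]_+$ for $i\ne k$ ($[a]_+=\max(a,0)$); replaces $b'_{ij}$ by $-b'_{ij}$ if $i=k$ or $j=k$, and by $b'_{ij}+\frac12(|b'_{ik}|b'_{kj}+b'_{ik}|b'_{kj}|)$ otherwise; and replaces $X'_k$ by $(X')^{-\mathbf e_k+\sum_i[b'_{ik}]_+\mathbf e_i}+(X')^{-\mathbf e_k+\sum_i[-b'_{ik}]_+\mathbf e_i}$, leaving the other $X'_j$ unchanged. The initial seed is $\Sigma_1=(\Lambda,\widetilde B,(X_1,X_2,X_3,y_1,y_2,y_3))$; $\mathcal A_q(Q)\subset\mathcal F$ is generated, over Laurent polynomials in $y_1,y_2,y_3$ with coefficients in $\mathbb{Z}[q^{\pm1/2}]$, by all quantum cluster variables (first three entries of $X'$ in seeds obtained from $\Sigma_1$ by finitely many mutations). Variables $X_m$, $m\in\mathbb{Z}$. The seed $\Sigma_m$ has cluster $(X_m,X_{m+1},X_{m+2})$: mutating $\Sigma_m$ in direction 1 replaces $X_m$ by $X_{m+3}$ and, after reordering the first three indices to $(X_{m+1},X_{m+2},X_{m+3})$, gives $\Sigma_{m+1}$; mutating $\Sigma_m$ in direction 3 replaces $X_{m+2}$ by $X_{m-1}$ and, after reordering to $(X_{m-1},X_m,X_{m+1})$, gives $\Sigma_{m-1}$.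 Elements $w,z,u_n$: $w=X^{(1,-1,0,0,1,0)}+X^{(0,-1,1,0,0,0)}$, $z=X^{(0,1,-1,1,0,1)}+X^{(-1,0,-1,1,0,0)}+X^{(-1,1,0,0,0,0)}$; $u_0=1$, $u_1=wz-q^{-1/2}X^{(0,0,0,1,0,1)}-q^{1/2}X^{(0,0,0,0,1,0)}$, $u_2=u_1^2-2X^{(0,0,0,1,1,1)}$, $u_{n+1}=u_1u_n-X^{(0,0,0,1,1,1)}u_{n-1}$ for $n\ge2$. *)

theory Defs
  imports Complex_Main "HOL-Library.Poly_Mapping" "HOL-Library.Product_Plus"
begin

text \<open>
  The group ring \<open>half_laurent\<close> of the additive group \<open>\<int>\<close> over \<open>\<int>\<close> is the ring of Laurent
  polynomials in \<open>q^(1/2)\<close>: the basis element at \<open>a\<close> stands for \<open>q^(a/2)\<close>.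
\<close>

type_synonym half_laurent = "int \<Rightarrow>\<^sub>0 int"

type_synonym Z6 = "int \<times> int \<times> int \<times> int \<times> int \<times> int"

text \<open>All indices run over \<open>1, \<dots>, 6\<close> (directions of mutation and columns of exchange matrices over
  \<open>1, 2, 3\<close>); values of index-dependent functions outside these ranges are irrelevant.\<close>

definition vec6 :: "(nat \<Rightarrow> int) \<Rightarrow> Z6" where
  "vec6 f = (f 1, f 2, f 3, f 4, f 5, f 6)"

definition coord :: "Z6 \<Rightarrow> nat \<Rightarrow> int" where
  "coord c i = (case c of (c1, c2, c3, c4, c5, c6) \<Rightarrow> [c1, c2, c3, c4, c5, c6] ! (i - 1))"

definition unit6 :: "nat \<Rightarrow> Z6" where
  "unit6 i = vec6 (\<lambda>j. if j = i then 1 else 0)"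

definition lambda0 :: "nat \<Rightarrow> nat \<Rightarrow> int" where
  "lambda0 i j =
    [[0,  0,  0, -1,  0,  0],
     [0,  0,  0,  0, -1,  0],
     [0,  0,  0,  0,  0, -1],
     [1,  0,  0,  0, -1, -1],
     [0,  1,  0,  1,  0, -1],
     [0,  0,  1,  1,  1,  0]] ! (i - 1) ! (j - 1)"

definition B0 :: "nat \<Rightarrow> nat \<Rightarrow> int" where
  "B0 i j =
    [[ 0,  1,  1],
     [-1,  0,  1],
     [-1, -1,  0],
     [ 1,  0,  0],
     [ 0,  1,  0],
     [ 0,  0,  1]] ! (i - 1) ! (j - 1)"

definition Lambda_form :: "Z6 \<Rightarrow> Z6 \<Rightarrow> int" where
  "Lambda_form c d = (\<Sum>i = 1..6. \<Sum>j = 1..6. coord c i * lambda0 i j * coord d j)"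

lemma coord_add: "i \<in> {1..6} \<Longrightarrow> coord (c + d) i = coord c i + coord d i"
proof -
  assume "i \<in> {1..6}"
  then have "i = 1 \<or> i = 2 \<or> i = 3 \<or> i = 4 \<or> i = 5 \<or> i = 6" by auto
  then show ?thesis
    by (cases c; cases d) (auto simp: coord_def plus_prod_def)
qed

lemma coord_zero: "i \<in> {1..6} \<Longrightarrow> coord 0 i = 0"
proof -
  assume "i \<in> {1..6}"
  then have "i = 1 \<or> i = 2 \<or> i = 3 \<or> i = 4 \<or> i = 5 \<or> i = 6" by auto
  then show ?thesis by (auto simp: coord_def zero_prod_def)
qed

lemma Lambda_form_add_left: "Lambda_form (c + c') d = Lambda_form c d + Lambda_form c' d"
  unfolding Lambda_form_def sum.distrib [symmetric]
  by (intro sum.cong refl) (simp add: coord_add algebra_simps)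

lemma Lambda_form_add_right: "Lambda_form c (d + d') = Lambda_form c d + Lambda_form c d'"
  unfolding Lambda_form_def sum.distrib [symmetric]
  by (intro sum.cong refl) (simp add: coord_add algebra_simps)

lemma Lambda_form_zero_left [simp]: "Lambda_form 0 d = 0"
  unfolding Lambda_form_def by (intro sum.neutral ballI) (simp add: coord_zero)

lemma Lambda_form_zero_right [simp]: "Lambda_form c 0 = 0"
  unfolding Lambda_form_def by (intro sum.neutral ballI) (simp add: coord_zero)


section \<open>The based quantum torus\<close>

text \<open>The product is the bilinear extension of \<open>X^c X^d = q^(\<Lambda>(c,d)/2) X^(c+d)\<close>.\<close>

definition twisted_mult ::
    "(Z6 \<Rightarrow>\<^sub>0 half_laurent) \<Rightarrow> (Z6 \<Rightarrow>\<^sub>0 half_laurent) \<Rightarrow> (Z6 \<Rightarrow>\<^sub>0 half_laurent)" where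
  "twisted_mult f g =
    (\<Sum>c \<in> Poly_Mapping.keys f. \<Sum>d \<in> Poly_Mapping.keys g.
      Poly_Mapping.single (c + d)
        (Poly_Mapping.lookup f c * Poly_Mapping.lookup g d *
          Poly_Mapping.single (Lambda_form c d) 1))"

lemma twisted_mult_superset:
  assumes "finite A" "Poly_Mapping.keys f \<subseteq> A" "finite B" "Poly_Mapping.keys g \<subseteq> B"
  shows "twisted_mult f g =
    (\<Sum>c \<in> A. \<Sum>d \<in> B.
      Poly_Mapping.single (c + d)
        (Poly_Mapping.lookup f c * Poly_Mapping.lookup g d *
          Poly_Mapping.single (Lambda_form c d) 1))"
proof -
  let ?t = "\<lambda>c d. Poly_Mapping.single (c + d)
        (Poly_Mapping.lookup f c * Poly_Mapping.lookup g d *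
          Poly_Mapping.single (Lambda_form c d) 1)"
  have "twisted_mult f g = (\<Sum>c \<in> Poly_Mapping.keys f. \<Sum>d \<in> B. ?t c d)"
    unfolding twisted_mult_def
    by (intro sum.cong refl sum.mono_neutral_left) (use assms in \<open>auto simp: in_keys_iff\<close>)
  also have "\<dots> = (\<Sum>c \<in> A. \<Sum>d \<in> B. ?t c d)"
    by (rule sum.mono_neutral_left) (use assms in \<open>auto simp: in_keys_iff\<close>)
  finally show ?thesis .
qed

lemma twisted_mult_add_left: "twisted_mult (f + f') g = twisted_mult f g + twisted_mult f' g"
proof -
  let ?A = "Poly_Mapping.keys f \<union> Poly_Mapping.keys f'"
  let ?B = "Poly_Mapping.keys g"
  have "Poly_Mapping.keys (f + f') \<subseteq> ?A" by (rule Poly_Mapping.keys_add)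
  then show ?thesis
    using twisted_mult_superset[of ?A "f + f'" ?B g] twisted_mult_superset[of ?A f ?B g]
      twisted_mult_superset[of ?A f' ?B g]
    by (simp add: lookup_add distrib_right single_add sum.distrib)
qed

lemma twisted_mult_add_right: "twisted_mult f (g + g') = twisted_mult f g + twisted_mult f g'"
proof -
  let ?A = "Poly_Mapping.keys f"
  let ?B = "Poly_Mapping.keys g \<union> Poly_Mapping.keys g'"
  have "Poly_Mapping.keys (g + g') \<subseteq> ?B" by (rule Poly_Mapping.keys_add)
  then show ?thesis
    using twisted_mult_superset[of ?A f ?B "g + g'"] twisted_mult_superset[of ?A f ?B g]
      twisted_mult_superset[of ?A f ?B g']
    by (simp add: lookup_add distrib_right distrib_left single_add sum.distrib)
qed

lemma twisted_mult_single:
  "twisted_mult (Poly_Mapping.single c a) (Poly_Mapping.single d b) =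
    Poly_Mapping.single (c + d) (a * b * Poly_Mapping.single (Lambda_form c d) 1)"
  using twisted_mult_superset[of "{c}" "Poly_Mapping.single c a" "{d}" "Poly_Mapping.single d b"]
  by simp

lemma poly_mapping_single_add_induct [case_names zero single add]:
  fixes f :: "'k \<Rightarrow>\<^sub>0 'b :: comm_monoid_add"
  assumes zero: "P 0" and single: "\<And>c a. P (Poly_Mapping.single c a)"
    and add: "\<And>f g. P f \<Longrightarrow> P g \<Longrightarrow> P (f + g)"
  shows "P f"
proof -
  have "P (\<Sum>c \<in> A. Poly_Mapping.single c (Poly_Mapping.lookup f c))" if "finite A" for A
    using that by (induction A rule: finite_induct) (auto intro: assms)
  moreover have "f = (\<Sum>c \<in> Poly_Mapping.keys f. Poly_Mapping.single c (Poly_Mapping.lookup f c))"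
    by (rule poly_mapping_eqI) (auto simp: lookup_sum lookup_single when_def in_keys_iff)
  ultimately show ?thesis by (metis finite_keys)
qed

lemma twisted_mult_zero_left [simp]: "twisted_mult 0 g = 0"
  by (simp add: twisted_mult_def)

lemma twisted_mult_zero_right [simp]: "twisted_mult f 0 = 0"
  by (simp add: twisted_mult_def)

lemma twisted_mult_assoc:
  "twisted_mult (twisted_mult f g) h = twisted_mult f (twisted_mult g h)"
proof (induction f rule: poly_mapping_single_add_induct)
  case (single c a)
  show ?case
  proof (induction g rule: poly_mapping_single_add_induct)
    case (single d b)
    show ?case
    proof (induction h rule: poly_mapping_single_add_induct)
      case (single e x)
      have "Poly_Mapping.single (Lambda_form c d) (1::int) *
              Poly_Mapping.single (Lambda_form c e + Lambda_form d e) 1 =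
            Poly_Mapping.single (Lambda_form d e) 1 *
              Poly_Mapping.single (Lambda_form c d + Lambda_form c e) 1"
        by (simp add: mult_single add_ac)
      then show ?case
        by (simp add: twisted_mult_single Lambda_form_add_left Lambda_form_add_right
            add.assoc) (simp add: mult_ac)
    qed (simp_all add: twisted_mult_add_right)
  qed (simp_all add: twisted_mult_add_left twisted_mult_add_right)
qed (simp_all add: twisted_mult_add_left)

lemma twisted_mult_one_left: "twisted_mult (Poly_Mapping.single 0 1) f = f"
  by (induction f rule: poly_mapping_single_add_induct)
    (simp_all add: twisted_mult_add_right twisted_mult_single del: single_one, simp_all)

lemma twisted_mult_one_right: "twisted_mult f (Poly_Mapping.single 0 1) = f"
  by (induction f rule: poly_mapping_single_add_induct)
    (simp_all add: twisted_mult_add_left twisted_mult_single del: single_one, simp_all)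

text \<open>A copy of the free \<open>half_laurent\<close>-module on \<open>Z6\<close>, kept apart because \<open>Poly_Mapping\<close> already
  equips that type with the untwisted product.\<close>

typedef quantum_torus = "UNIV :: (Z6 \<Rightarrow>\<^sub>0 half_laurent) set"
  morphisms torus_coeffs Torus by simp

setup_lifting type_definition_quantum_torus

instantiation quantum_torus :: ring_1
begin

lift_definition zero_quantum_torus :: quantum_torus is "0" .
lift_definition one_quantum_torus :: quantum_torus is "Poly_Mapping.single 0 1" .
lift_definition plus_quantum_torus :: "quantum_torus \<Rightarrow> quantum_torus \<Rightarrow> quantum_torus" is "(+)" .
lift_definition minus_quantum_torus :: "quantum_torus \<Rightarrow> quantum_torus \<Rightarrow> quantum_torus" is "(-)" .
lift_definition uminus_quantum_torus :: "quantum_torus \<Rightarrow> quantum_torus" is "uminus" .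
lift_definition times_quantum_torus :: "quantum_torus \<Rightarrow> quantum_torus \<Rightarrow> quantum_torus"
  is twisted_mult .

instance
proof
  fix a b c :: quantum_torus
  show "a * b * c = a * (b * c)" by transfer (rule twisted_mult_assoc)
  show "1 * a = a" by transfer (rule twisted_mult_one_left)
  show "a * 1 = a" by transfer (rule twisted_mult_one_right)
  show "(a + b) * c = a * c + b * c" by transfer (rule twisted_mult_add_left)
  show "a * (b + c) = a * b + a * c" by transfer (rule twisted_mult_add_right)
  show "a + b + c = a + (b + c)" by transfer (rule add.assoc)
  show "a + b = b + a" by transfer (rule add.commute)
  show "0 + a = a" by transfer simp
  show "- a + a = 0" by transfer simp
  show "a - b = a + - b" by transfer simp
  show "(0 :: quantum_torus) \<noteq> 1"
  proof transfer
    have "Poly_Mapping.lookup (Poly_Mapping.single (0::Z6) (1::half_laurent)) 0 \<noteq>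
        Poly_Mapping.lookup 0 (0::Z6)"
      by simp
    then show "(0 :: Z6 \<Rightarrow>\<^sub>0 half_laurent) \<noteq> Poly_Mapping.single 0 1" by metis
  qed
qed

end

text \<open>\<open>torus_X c\<close> is \<open>X^c\<close>. \<open>torus_q r\<close> is \<open>q^r\<close>, meaningful only for \<open>r\<close> a half-integer,
  i.e. when \<open>2 * r\<close> is an integer; the floor only serves to turn \<open>2 * r\<close> into an \<open>int\<close>.\<close>

definition torus_X :: "Z6 \<Rightarrow> quantum_torus" where
  "torus_X c = Torus (Poly_Mapping.single c 1)"

definition torus_q :: "rat \<Rightarrow> quantum_torus" where
  "torus_q r = Torus (Poly_Mapping.single 0 (Poly_Mapping.single \<lfloor>2 * r\<rfloor> 1))"

lemma torus_X_mult:
  "torus_X c * torus_X d = torus_q (of_int (Lambda_form c d) / 2) * torus_X (c + d)"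
  unfolding torus_X_def torus_q_def
  by (simp add: times_quantum_torus.abs_eq eq_onp_def twisted_mult_single)

lemma torus_q_central: "torus_q r * x = x * torus_q r"
proof -
  have "twisted_mult (Poly_Mapping.single 0 a) f = twisted_mult f (Poly_Mapping.single 0 a)" for a f
    by (induction f rule: poly_mapping_single_add_induct)
      (simp_all add: twisted_mult_add_left twisted_mult_add_right twisted_mult_single mult_ac)
  then show ?thesis
    unfolding torus_q_def by (cases x) (simp add: times_quantum_torus.abs_eq eq_onp_def)
qed


section \<open>The skew-field of fractions\<close>

definition is_skew_field_of_fractions :: "(quantum_torus \<Rightarrow> 'f :: division_ring) \<Rightarrow> bool" where
  "is_skew_field_of_fractions \<iota> \<longleftrightarrow>
    \<iota> 1 = 1 \<and>
    (\<forall>a b. \<iota> (a + b) = \<iota> a + \<iota> b) \<and>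
    (\<forall>a b. \<iota> (a * b) = \<iota> a * \<iota> b) \<and>
    inj \<iota> \<and>
    (\<forall>x. \<exists>a b. b \<noteq> 0 \<and> x = \<iota> a * inverse (\<iota> b))"


section \<open>Quantum seeds and mutation\<close>

record 'f quantum_seed =
  seed_Lambda :: "nat \<Rightarrow> nat \<Rightarrow> int"
  seed_B :: "nat \<Rightarrow> nat \<Rightarrow> int"
  seed_X :: "nat \<Rightarrow> 'f"

definition seed_monomial ::
    "(quantum_torus \<Rightarrow> 'f :: division_ring) \<Rightarrow> 'f quantum_seed \<Rightarrow> (nat \<Rightarrow> int) \<Rightarrow> 'f" where
  "seed_monomial \<iota> S c =
    \<iota> (torus_q (- (1/2) * of_int (\<Sum>j = 1..6. \<Sum>i = 1..<j. c i * c j * seed_Lambda S i j))) *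
    prod_list (map (\<lambda>i. seed_X S i powi c i) [1, 2, 3, 4, 5, 6])"

definition mutation_E :: "nat \<Rightarrow> (nat \<Rightarrow> nat \<Rightarrow> int) \<Rightarrow> nat \<Rightarrow> nat \<Rightarrow> int" where
  "mutation_E k B i j =
    (if j \<noteq> k then (if i = j then 1 else 0)
     else if i = k then -1
     else max (- B i k) 0)"

text \<open>The division by \<open>2\<close> in the exchange matrix is exact.\<close>

definition mutate ::
    "(quantum_torus \<Rightarrow> 'f :: division_ring) \<Rightarrow> nat \<Rightarrow> 'f quantum_seed \<Rightarrow> 'f quantum_seed" where
  "mutate \<iota> k S =
    (let L = seed_Lambda S; B = seed_B S; E = mutation_E k B in
      \<lparr>seed_Lambda = (\<lambda>i j. \<Sum>r = 1..6. \<Sum>s = 1..6. E r i * L r s * E s j),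
       seed_B = (\<lambda>i j.
         if i = k \<or> j = k then - B i j
         else B i j + (\<bar>B i k\<bar> * B k j + B i k * \<bar>B k j\<bar>) div 2),
       seed_X = (seed_X S)(k :=
         seed_monomial \<iota> S (\<lambda>i. (if i = k then -1 else 0) + max (B i k) 0) +
         seed_monomial \<iota> S (\<lambda>i. (if i = k then -1 else 0) + max (- B i k) 0))\<rparr>)"

definition initial_seed :: "(quantum_torus \<Rightarrow> 'f :: division_ring) \<Rightarrow> 'f quantum_seed" where
  "initial_seed \<iota> =
    \<lparr>seed_Lambda = lambda0, seed_B = B0, seed_X = (\<lambda>i. \<iota> (torus_X (unit6 i)))\<rparr>"

inductive_set mutation_class :: "(quantum_torus \<Rightarrow> 'f :: division_ring) \<Rightarrow> 'f quantum_seed set"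
  for \<iota> where
  initial: "initial_seed \<iota> \<in> mutation_class \<iota>"
| step: "S \<in> mutation_class \<iota> \<Longrightarrow> k \<in> {1, 2, 3} \<Longrightarrow> mutate \<iota> k S \<in> mutation_class \<iota>"

text \<open>The subring of the skew-field generated by the Laurent polynomials in \<open>y\<^sub>1, y\<^sub>2, y\<^sub>3\<close> over
  \<open>\<int>[q^(1/2), q^(-1/2)]\<close> and all quantum cluster variables.\<close>

inductive_set quantum_cluster_algebra :: "(quantum_torus \<Rightarrow> 'f :: division_ring) \<Rightarrow> 'f set"
  for \<iota> where
  one: "1 \<in> quantum_cluster_algebra \<iota>"
| q_half: "\<iota> (torus_q (1/2)) \<in> quantum_cluster_algebra \<iota>"
| q_half_inv: "\<iota> (torus_q (- (1/2))) \<in> quantum_cluster_algebra \<iota>"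
| frozen: "i \<in> {4, 5, 6} \<Longrightarrow> \<iota> (torus_X (unit6 i)) \<in> quantum_cluster_algebra \<iota>"
| frozen_inv: "i \<in> {4, 5, 6} \<Longrightarrow> inverse (\<iota> (torus_X (unit6 i))) \<in> quantum_cluster_algebra \<iota>"
| cluster_variable:
    "S \<in> mutation_class \<iota> \<Longrightarrow> i \<in> {1, 2, 3} \<Longrightarrow> seed_X S i \<in> quantum_cluster_algebra \<iota>"
| diff: "a \<in> quantum_cluster_algebra \<iota> \<Longrightarrow> b \<in> quantum_cluster_algebra \<iota> \<Longrightarrow>
    a - b \<in> quantum_cluster_algebra \<iota>"
| mult: "a \<in> quantum_cluster_algebra \<iota> \<Longrightarrow> b \<in> quantum_cluster_algebra \<iota> \<Longrightarrow>
    a * b \<in> quantum_cluster_algebra \<iota>"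


section \<open>The variables \<open>X\<^sub>m\<close>\<close>

text \<open>Position \<open>i\<close> of the reordered seed is position \<open>p i\<close> of the old one.\<close>

definition reorder :: "(nat \<Rightarrow> nat) \<Rightarrow> 'f quantum_seed \<Rightarrow> 'f quantum_seed" where
  "reorder p S =
    \<lparr>seed_Lambda = (\<lambda>i j. seed_Lambda S (p i) (p j)),
     seed_B = (\<lambda>i j. seed_B S (p i) (p j)),
     seed_X = (\<lambda>i. seed_X S (p i))\<rparr>"

text \<open>Mutation in direction 1 turns \<open>(X\<^sub>m, X\<^sub>m\<^sub>+\<^sub>1, X\<^sub>m\<^sub>+\<^sub>2)\<close> into \<open>(X\<^sub>m\<^sub>+\<^sub>3, X\<^sub>m\<^sub>+\<^sub>1, X\<^sub>m\<^sub>+\<^sub>2)\<close>, mutation in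
  direction 3 turns it into \<open>(X\<^sub>m, X\<^sub>m\<^sub>+\<^sub>1, X\<^sub>m\<^sub>-\<^sub>1)\<close>; the new variable is then moved to the last
  respectively the first of the three places.\<close>

definition next_seed ::
    "(quantum_torus \<Rightarrow> 'f :: division_ring) \<Rightarrow> 'f quantum_seed \<Rightarrow> 'f quantum_seed" where
  "next_seed \<iota> S = reorder (id(1 := 2, 2 := 3, 3 := 1)) (mutate \<iota> 1 S)"

definition prev_seed ::
    "(quantum_torus \<Rightarrow> 'f :: division_ring) \<Rightarrow> 'f quantum_seed \<Rightarrow> 'f quantum_seed" where
  "prev_seed \<iota> S = reorder (id(1 := 3, 2 := 1, 3 := 2)) (mutate \<iota> 3 S)"

definition Sigma_seed :: "(quantum_torus \<Rightarrow> 'f :: division_ring) \<Rightarrow> int \<Rightarrow> 'f quantum_seed" where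
  "Sigma_seed \<iota> m =
    (if m \<ge> 1 then (next_seed \<iota> ^^ nat (m - 1)) (initial_seed \<iota>)
     else (prev_seed \<iota> ^^ nat (1 - m)) (initial_seed \<iota>))"

definition cluster_X :: "(quantum_torus \<Rightarrow> 'f :: division_ring) \<Rightarrow> int \<Rightarrow> 'f" where
  "cluster_X \<iota> m = seed_X (Sigma_seed \<iota> m) 1"


section \<open>The elements \<open>w\<close>, \<open>z\<close>, \<open>u\<^sub>n\<close>\<close>

definition w_elem :: quantum_torus where
  "w_elem = torus_X (1, -1, 0, 0, 1, 0) + torus_X (0, -1, 1, 0, 0, 0)"

definition z_elem :: quantum_torus where
  "z_elem = torus_X (0, 1, -1, 1, 0, 1) + torus_X (-1, 0, -1, 1, 0, 0)
    + torus_X (-1, 1, 0, 0, 0, 0)"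

definition u1_elem :: quantum_torus where
  "u1_elem = w_elem * z_elem - torus_q (- (1/2)) * torus_X (0, 0, 0, 1, 0, 1)
    - torus_q (1/2) * torus_X (0, 0, 0, 0, 1, 0)"

fun u_elem :: "nat \<Rightarrow> quantum_torus" where
  "u_elem 0 = 1"
| "u_elem (Suc 0) = u1_elem"
| "u_elem (Suc (Suc 0)) = u1_elem ^ 2 - 2 * torus_X (0, 0, 0, 1, 1, 1)"
| "u_elem (Suc (Suc (Suc n))) =
    u1_elem * u_elem (Suc (Suc n)) - torus_X (0, 0, 0, 1, 1, 1) * u_elem (Suc n)"

end

theory Submission imports Defs
begin

text \<open>
  Write \<open>h = q^(1/2)\<close>, \<open>C = X^(e4+e5+e6)\<close>, \<open>W\<^sub>i = w\<close>, \<open>A\<^sub>i = X^e5\<close> for even \<open>i\<close> and \<open>W\<^sub>i = z\<close>,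
  \<open>A\<^sub>i = X^(e4+e6)\<close> for odd \<open>i\<close>. The two-sided sequence \<open>x\<^sub>i\<close> with \<open>x\<^sub>1 = X\<^sub>1\<close>, \<open>x\<^sub>2 = X\<^sub>2\<close> and
  \<open>W\<^sub>i x\<^sub>i = x\<^sub>i\<^sub>+\<^sub>1 + h A\<^sub>i x\<^sub>i\<^sub>-\<^sub>1\<close> lives in the quantum torus, \<open>x\<^sub>i\<close> commutes with its neighbours at distance at most 2, and
  \<open>x\<^sub>i x\<^sub>i\<^sub>+\<^sub>3 = x\<^sub>i\<^sub>+\<^sub>1 x\<^sub>i\<^sub>+\<^sub>2 + h^(-1) R\<^sub>i\<close> with a frozen monomial \<open>R\<^sub>i = X^(\<rho>\<^sub>i)\<close>. Following the seeds shows that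
  \<open>X\<^sub>m = x\<^sub>m\<close> for \<open>m \<ge> 1\<close> and \<open>X\<^sub>m = h X^(-\<rho>\<^sub>m) x\<^sub>m\<close> for \<open>m \<le> 0\<close>. Unlike the \<open>X\<^sub>m\<close>, the \<open>x\<^sub>i\<close> satisfy
  product formulas that are uniform in \<open>i\<close>: multiplying \<open>x\<^sub>i x\<^sub>j\<close> on the left by \<open>W\<^sub>i\<close> expresses
  \<open>x\<^sub>i\<^sub>-\<^sub>1 x\<^sub>j\<close> through shorter products, and the sums \<open>g\<^sub>n\<close> of the theorem obey
  \<open>u\<^sub>1 g\<^sub>k = C g\<^sub>k\<^sub>-\<^sub>1 + g\<^sub>k\<^sub>+\<^sub>1\<close>, up to the term \<open>-(q C)^((k-1)/2)\<close> for odd \<open>k\<close>. The case distinctions in the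
  theorem only record which of the factors on the right have a nonpositive index.
\<close>

section \<open>Arithmetic in the quantum torus\<close>

definition qh :: "int \<Rightarrow> quantum_torus" where
  "qh k = torus_q (of_int k / 2)"

lemma qh_eq_Torus: "qh k = Torus (Poly_Mapping.single 0 (Poly_Mapping.single k 1))"
proof -
  have "\<lfloor>2 * (of_int k / 2 :: rat)\<rfloor> = k" by simp
  then show ?thesis unfolding qh_def torus_q_def by metis
qed

lemma torus_q_half_int: "2 * r = of_int k \<Longrightarrow> torus_q r = qh k"
  by (simp add: qh_eq_Torus torus_q_def)

lemma qh_0 [simp]: "qh 0 = 1"
  by (simp add: qh_eq_Torus one_quantum_torus_def)

lemma qh_mult: "qh a * qh b = qh (a + b)"
  by (simp add: qh_eq_Torus times_quantum_torus.abs_eq twisted_mult_single mult_single)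

lemma qh_mult_left: "qh a * (qh b * x) = qh (a + b) * x"
  by (simp add: qh_mult mult.assoc [symmetric])

lemma qh_commute: "x * qh k = qh k * x"
  by (simp add: qh_def torus_q_central)

lemma qh_left_commute: "x * (qh k * y) = qh k * (x * y)"
  by (metis qh_commute mult.assoc)

lemma qh_mult_cancel [simp]: "qh k * x = qh k * y \<longleftrightarrow> x = y"
  by (metis qh_mult qh_0 add.left_inverse mult.assoc mult_1_left)

lemma qh_inj [simp]: "qh a = qh b \<longleftrightarrow> a = b"
proof
  assume "qh a = qh b"
  then have "Poly_Mapping.lookup (Poly_Mapping.lookup (torus_coeffs (qh a)) 0) a =
      Poly_Mapping.lookup (Poly_Mapping.lookup (torus_coeffs (qh b)) 0) a" by simp
  then show "a = b"
    by (simp add: qh_eq_Torus Torus_inverse lookup_single when_def split: if_splits)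
qed simp

lemma Lambda_form_explicit:
  "Lambda_form (a1, a2, a3, a4, a5, a6) (b1, b2, b3, b4, b5, b6) =
    a4 * b1 - a1 * b4 + a5 * b2 - a2 * b5 + a6 * b3 - a3 * b6
    + a5 * b4 - a4 * b5 + a6 * b4 - a4 * b6 + a6 * b5 - a5 * b6"
proof -
  have *: "{1..6::nat} = {1, 2, 3, 4, 5, 6}" by auto
  show ?thesis unfolding Lambda_form_def * by (simp add: coord_def lambda0_def)
qed

lemma torus_X_0 [simp]: "torus_X (0, 0, 0, 0, 0, 0) = 1"
  by (simp add: torus_X_def one_quantum_torus_def zero_prod_def [symmetric])

lemma torus_X_times:
  "torus_X (a1, a2, a3, a4, a5, a6) * torus_X (b1, b2, b3, b4, b5, b6) =
    qh (a4 * b1 - a1 * b4 + a5 * b2 - a2 * b5 + a6 * b3 - a3 * b6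
      + a5 * b4 - a4 * b5 + a6 * b4 - a4 * b6 + a6 * b5 - a5 * b6) *
    torus_X (a1 + b1, a2 + b2, a3 + b3, a4 + b4, a5 + b5, a6 + b6)"
  by (simp add: torus_X_mult Lambda_form_explicit qh_def plus_prod_def)

lemma torus_X_times_left:
  "torus_X (a1, a2, a3, a4, a5, a6) * (torus_X (b1, b2, b3, b4, b5, b6) * x) =
    qh (a4 * b1 - a1 * b4 + a5 * b2 - a2 * b5 + a6 * b3 - a3 * b6
      + a5 * b4 - a4 * b5 + a6 * b4 - a4 * b6 + a6 * b5 - a5 * b6) *
    (torus_X (a1 + b1, a2 + b2, a3 + b3, a4 + b4, a5 + b5, a6 + b6) * x)"
  by (simp only: mult.assoc [symmetric] torus_X_times)

text \<open>A normal form for explicit elements: a sum of terms \<open>qh k * torus_X c\<close>. The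
  commutation rules are instantiated to basis elements so that powers of q only ever move to the
  left. Identities between explicitly given elements then reduce to comparing terms.\<close>

lemmas torus_norm = distrib_left distrib_right left_diff_distrib right_diff_distrib mult.assoc
  qh_mult qh_mult_left qh_commute [of "torus_X _"] qh_left_commute [of "torus_X _"]
  torus_X_times torus_X_times_left

definition yX :: "int \<Rightarrow> int \<Rightarrow> int \<Rightarrow> quantum_torus" where
  "yX a b c = torus_X (0, 0, 0, a, b, c)"

lemma yX_0 [simp]: "yX 0 0 0 = 1"
  by (simp add: yX_def)

lemma yX_mult: "yX a b c * yX a' b' c' =
    qh (b * a' - a * b' + c * a' - a * c' + c * b' - b * c') * yX (a + a') (b + b') (c + c')"
  by (simp add: yX_def torus_X_times algebra_simps)

lemma yX_mult_left: "yX a b c * (yX a' b' c' * x) =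
    qh (b * a' - a * b' + c * a' - a * c' + c * b' - b * c') * (yX (a + a') (b + b') (c + c') * x)"
  by (simp only: mult.assoc [symmetric] yX_mult)

lemma yX_inverse [simp]: "yX a b c * (yX (- a) (- b) (- c) * x) = x"
  "yX (- a) (- b) (- c) * (yX a b c * x) = x"
  by (simp_all add: yX_mult_left)

lemma yX_mult_cancel [simp]: "yX a b c * x = yX a b c * y \<longleftrightarrow> x = y"
  by (metis yX_inverse(2))

section \<open>The gauged sequence\<close>

definition W_elem :: "int \<Rightarrow> quantum_torus" where
  "W_elem i = (if even i then w_elem else z_elem)"

definition A_mon :: "int \<Rightarrow> quantum_torus" where
  "A_mon i = (if even i then yX 0 1 0 else yX 1 0 1)"

definition A_mon_inv :: "int \<Rightarrow> quantum_torus" where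
  "A_mon_inv i = (if even i then yX 0 (-1) 0 else yX (-1) 0 (-1))"

text \<open>A recursion running in both directions has no termination order, so the two halves are
  separate: \<open>seq_up n\<close> is \<open>x_(n+1)\<close> and \<open>seq_down n\<close> is
  \<open>x_(2-n)\<close>. Both start from the pair \<open>x_1\<close>, \<open>x_2\<close>; the
  downward step solves the three-term relation for \<open>x_(i-1)\<close>, which is possible because
  \<open>A_i\<close> is a unit.\<close>

fun seq_up :: "nat \<Rightarrow> quantum_torus" where
  "seq_up 0 = torus_X (1, 0, 0, 0, 0, 0)"
| "seq_up (Suc 0) = torus_X (0, 1, 0, 0, 0, 0)"
| "seq_up (Suc (Suc n)) =
    W_elem (int n + 2) * seq_up (Suc n) - qh 1 * (A_mon (int n + 2) * seq_up n)"

fun seq_down :: "nat \<Rightarrow> quantum_torus" where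
  "seq_down 0 = torus_X (0, 1, 0, 0, 0, 0)"
| "seq_down (Suc 0) = torus_X (1, 0, 0, 0, 0, 0)"
| "seq_down (Suc (Suc n)) =
    qh (-1) * (A_mon_inv (1 - int n) * (W_elem (1 - int n) * seq_down (Suc n) - seq_down n))"

definition gauged_X :: "int \<Rightarrow> quantum_torus" where
  "gauged_X i = (if i \<ge> 1 then seq_up (nat (i - 1)) else seq_down (nat (2 - i)))"

lemma A_mon_inverse [simp]: "A_mon i * (A_mon_inv i * x) = x" "A_mon_inv i * (A_mon i * x) = x"
  using yX_inverse [of 0 1 0] yX_inverse [of 1 0 1] by (simp_all add: A_mon_def A_mon_inv_def)

lemma A_mon_mult_cancel [simp]: "A_mon i * x = A_mon i * y \<longleftrightarrow> x = y"
  by (metis A_mon_inverse(2))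

lemma W_elem_gauged_X: "W_elem i * gauged_X i = gauged_X (i + 1) + qh 1 * (A_mon i * gauged_X (i - 1))"
proof -
  consider "i \<ge> 2" | "i = 1" | "i \<le> 0" by linarith
  then show ?thesis
  proof cases
    case 1
    define n where "n = nat (i - 2)"
    have i: "i = int n + 2" using 1 by (simp add: n_def)
    have "nat (int n + 2) = Suc (Suc n)" "nat (2 + int n) = Suc (Suc n)" "nat (1 + int n) = Suc n" by linarith+
    then show ?thesis by (simp add: i gauged_X_def)
  next
    case 2
    have "nat 2 = Suc (Suc 0)" by simp
    then show ?thesis by (simp add: 2 gauged_X_def qh_left_commute [of "A_mon _"] qh_mult_left numeral_2_eq_2)
  next
    case 3
    define n where "n = nat (1 - i)"
    have i: "i = 1 - int n" using 3 by (simp add: n_def)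
    have *: "nat (2 + int n) = Suc (Suc n)" "nat (1 + int n) = Suc n" by linarith+
    \<comment> \<open>For \<open>n = 1\<close> the index \<open>i + 1\<close> equals 1, where
      \<open>gauged_X\<close> is defined through \<open>seq_up\<close>; the two halves agree
      there.\<close>
    have "gauged_X (i + 1) = seq_down n"
      using 3 by (cases "n = 1") (simp_all add: i gauged_X_def)
    with 3 * show ?thesis by (simp add: i gauged_X_def qh_left_commute [of "A_mon _"] qh_mult_left)
  qed
qed

lemma gauged_X_step_up: "gauged_X (i + 1) = W_elem i * gauged_X i - qh 1 * (A_mon i * gauged_X (i - 1))"
  by (simp add: W_elem_gauged_X)

lemma gauged_X_step_down: "gauged_X (i - 1) = qh (-1) * (A_mon_inv i * (W_elem i * gauged_X i - gauged_X (i + 1)))"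
  by (simp add: W_elem_gauged_X qh_left_commute [of "A_mon_inv _"] qh_mult_left)

text \<open>Induction for second-order recursions that can be solved in both directions: ordinary
  two-sided induction on the conjunction of the claims at \<open>i\<close> and
  \<open>i + 1\<close>.\<close>

lemma int_two_step_induct [case_names base1 base2 up down]:
  fixes P :: "int \<Rightarrow> bool"
  assumes "P k" "P (k + 1)"
    and up: "\<And>i. P i \<Longrightarrow> P (i + 1) \<Longrightarrow> P (i + 2)"
    and down: "\<And>i. P (i + 1) \<Longrightarrow> P (i + 2) \<Longrightarrow> P i"
  shows "P i"
proof -
  have "P i \<and> P (i + 1)"
  proof (induction i rule: int_induct [where k = k])
    case (step1 i) then show ?case using up [of i] by (simp add: add.assoc)
  next
    case (step2 i) then show ?case using down [of "i - 1"] by (simp add: add.commute)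
  qed (use assms in auto)
  then show ?thesis ..
qed

section \<open>Quasi-commutation with frozen monomials\<close>

definition qcomm :: "int \<Rightarrow> quantum_torus \<Rightarrow> quantum_torus \<Rightarrow> bool" where
  "qcomm k x y \<longleftrightarrow> x * y = qh k * (y * x)"

lemma qcomm_left_commute: "qcomm k x y \<Longrightarrow> x * (y * z) = qh k * (y * (x * z))"
  by (metis qcomm_def mult.assoc)

lemma qcomm_cong: "qcomm k x y \<Longrightarrow> k = l \<Longrightarrow> qcomm l x y"
  by simp

text \<open>For a fixed right argument the exponent behaves like a degree: it adds up in products,
  and the elements of a given exponent are closed under differences (\<open>qcomm_diff\<close>) and
  under multiplication by powers of q (\<open>qcomm_qh\<close>).\<close>

lemma qcomm_mult: "qcomm k x z \<Longrightarrow> qcomm l y z \<Longrightarrow> qcomm (k + l) (x * y) z"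
  by (simp add: qcomm_def mult.assoc qh_left_commute [of x] qh_mult_left add.commute)
    (metis (no_types, lifting) add.commute mult.assoc qh_mult_left)

lemma qcomm_diff: "qcomm k x z \<Longrightarrow> qcomm k y z \<Longrightarrow> qcomm k (x - y) z"
  by (simp add: qcomm_def algebra_simps)

lemma qcomm_qh: "qcomm k x z \<Longrightarrow> qcomm k (qh j * x) z"
  by (simp add: qcomm_def mult.assoc qh_left_commute [of z] qh_mult_left add.commute)

lemma qcomm_yX: "qcomm (2 * (b * a' - a * b' + c * a' - a * c' + c * b' - b * c'))
    (yX a b c) (yX a' b' c')"
  by (simp add: qcomm_def yX_mult qh_mult_left algebra_simps)

text \<open>All summands of \<open>w_elem\<close> have the same exponent against a frozen monomial,
  and so have all summands of \<open>z_elem\<close>; both elements are homogeneous.\<close>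

lemma qcomm_W_elem: "qcomm (if even i then 2 * (b - c) else 2 * (a - b)) (W_elem i) (yX a b c)"
  by (simp add: qcomm_def W_elem_def w_elem_def z_elem_def yX_def torus_norm algebra_simps)

lemma qcomm_A_mon: "qcomm (2 * (a - c)) (A_mon i) (yX a b c)"
  by (simp add: qcomm_def A_mon_def yX_mult qh_mult_left algebra_simps)

lemma qcomm_A_mon_inv: "qcomm (2 * (c - a)) (A_mon_inv i) (yX a b c)"
  by (simp add: qcomm_def A_mon_inv_def yX_mult qh_mult_left algebra_simps)

text \<open>Half the exponent of \<open>x_i\<close> against \<open>yX a b c\<close>. It solves
  \<open>deg x_(i+2) = deg x_(i+1) + deg W_(i+1) = deg x_i + deg A_(i+1)\<close> with the values
  \<open>- a\<close> at 1 and \<open>- b\<close> at 2.\<close>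

definition y_degree :: "int \<Rightarrow> int \<Rightarrow> int \<Rightarrow> int \<Rightarrow> int" where
  "y_degree i a b c = (i div 2 - 1) * a + (i mod 2 - 1) * b + (1 - i div 2 - i mod 2) * c"

lemma qcomm_gauged_X: "qcomm (2 * y_degree i a b c) (gauged_X i) (yX a b c)"
proof (induction i rule: int_two_step_induct [where k = 1])
  case base1
  show ?case by (simp add: qcomm_def y_degree_def gauged_X_def yX_def torus_norm)
next
  case base2
  show ?case by (simp add: qcomm_def y_degree_def gauged_X_def yX_def torus_norm)
next
  case (up i)
  have e: "gauged_X (i + 2) = W_elem (i + 1) * gauged_X (i + 1) - qh 1 * (A_mon (i + 1) * gauged_X i)"
    using gauged_X_step_up [of "i + 1"] by (simp add: add.assoc)
  have "y_degree (i + 2) a b c = y_degree (i + 1) a b c + (if even (i + 1) then b - c else a - b)"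
    "y_degree (i + 2) a b c = y_degree i a b c + (a - c)"
    by (cases "even i"; auto elim!: evenE oddE simp: y_degree_def algebra_simps)+
  then show ?case unfolding e
    by (intro qcomm_diff qcomm_qh qcomm_cong [OF qcomm_mult [OF qcomm_W_elem up(2)]]
      qcomm_cong [OF qcomm_mult [OF qcomm_A_mon up(1)]]) auto
next
  case (down i)
  have e: "gauged_X i = qh (-1) * (A_mon_inv (i + 1) * (W_elem (i + 1) * gauged_X (i + 1) - gauged_X (i + 2)))"
    using gauged_X_step_down [of "i + 1"] by (simp add: add.assoc)
  have *: "y_degree (i + 2) a b c = y_degree (i + 1) a b c + (if even (i + 1) then b - c else a - b)"
    "y_degree (i + 2) a b c = y_degree i a b c + (a - c)"
    by (cases "even i"; auto elim!: evenE oddE simp: y_degree_def algebra_simps)+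
  have "qcomm (2 * y_degree (i + 2) a b c) (W_elem (i + 1) * gauged_X (i + 1) - gauged_X (i + 2)) (yX a b c)"
    using * by (intro qcomm_diff down(2) qcomm_cong [OF qcomm_mult [OF qcomm_W_elem down(1)]]) auto
  then show ?case unfolding e using *
    by (intro qcomm_qh qcomm_cong [OF qcomm_mult [OF qcomm_A_mon_inv]]) auto
qed

section \<open>The element u_1 and the recursions it yields\<close>

abbreviation yC :: quantum_torus where "yC \<equiv> yX 1 1 1"

text \<open>For \<open>i = 2k\<close> the exponent is \<open>(k, k, k-1)\<close>, for
  \<open>i = 2k+1\<close> it is \<open>(k+1, k, k)\<close>. It is \<open>(1, 0, 0)\<close> at
  \<open>i = 1\<close>, and passing from \<open>i\<close> to \<open>i+1\<close> adds the exponent of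
  \<open>A_(i+1)\<close>.\<close>

definition R_mon :: "int \<Rightarrow> quantum_torus" where
  "R_mon i = yX (i div 2 + i mod 2) (i div 2) (i div 2 - 1 + i mod 2)"

lemma parity_shift [simp]: "W_elem (i + 2) = W_elem i" "W_elem (i - 2) = W_elem i" "A_mon (i + 2) = A_mon i" "A_mon (i - 2) = A_mon i"
  "W_elem (i + 3) = W_elem (i + 1)" "A_mon (i + 3) = A_mon (i + 1)" "W_elem (i - 1) = W_elem (i + 1)" "A_mon (i - 1) = A_mon (i + 1)"
  by (simp_all add: W_elem_def A_mon_def)

text \<open>For even \<open>i\<close> this is the definition of \<open>u1_elem\<close>. For odd
  \<open>i\<close> it says that reversing the order of \<open>w_elem\<close> and
  \<open>z_elem\<close> only exchanges the powers of q at the two frozen monomials.\<close>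

lemma W_elem_W_elem_up: "W_elem i * W_elem (i + 1) = u1_elem + qh (-1) * A_mon (i + 1) + qh 1 * A_mon i"
proof -
  have "torus_q (1 / 2) = qh 1" "torus_q (- (1 / 2)) = qh (- 1)"
    by (rule torus_q_half_int; simp)+
  then show ?thesis
    by (cases "even i"; simp add: W_elem_def u1_elem_def w_elem_def z_elem_def A_mon_def yX_def torus_norm)
qed

lemma W_elem_W_elem_down: "W_elem (i + 1) * W_elem i = u1_elem + qh (-1) * A_mon i + qh 1 * A_mon (i + 1)"
  using W_elem_W_elem_up [of "i + 1"] by (simp add: add.assoc)

lemma A_mon_A_mon: "A_mon i * A_mon (i + 1) = yC" "A_mon (i + 1) * A_mon i = yC"
  by (cases "even i"; simp add: A_mon_def yX_mult)+

lemma A_mon_A_mon_left: "A_mon i * (A_mon (i + 1) * x) = yC * x" "A_mon (i + 1) * (A_mon i * x) = yC * x"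
  "A_mon i * (A_mon (1 + i) * x) = yC * x"
  by (simp_all add: mult.assoc [symmetric] A_mon_A_mon add.commute [of 1])

lemma qcomm_u1: "qcomm (2 * (a - c)) u1_elem (yX a b c)"
proof -
  have u: "u1_elem = W_elem 0 * W_elem 1 - qh (-1) * A_mon 1 - qh 1 * A_mon 0"
    using W_elem_W_elem_up [of 0] by simp
  have "qcomm (2 * (a - c)) (W_elem 0 * W_elem 1) (yX a b c)"
    by (rule qcomm_cong [OF qcomm_mult [OF qcomm_W_elem qcomm_W_elem]]) simp
  then show ?thesis unfolding u by (intro qcomm_diff qcomm_qh qcomm_A_mon)
qed

lemma qcomm_W_elem_A_mon: "qcomm (if even (i - j) then 2 else - 2) (W_elem i) (A_mon j)"
  unfolding A_mon_def by (cases "even j"; simp only: if_True if_False; rule qcomm_cong [OF qcomm_W_elem]; simp)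

lemma y_degree_parity: "y_degree i 1 1 1 = - 1" 
  "y_degree i 0 1 0 = (if even i then - 1 else 0)" "y_degree i 1 0 1 = (if even i then 0 else - 1)"
  by (cases "even i"; auto elim!: evenE oddE simp: y_degree_def)+

lemma qcomm_u1_A_mon: "qcomm 0 u1_elem (A_mon i)"
  using qcomm_u1 [of 0 0 1] qcomm_u1 [of 1 1 0] by (simp add: A_mon_def)

lemma qcomm_A_mon_C: "qcomm 0 (A_mon i) yC"
  using qcomm_A_mon [of 1 1 i 1] by simp

lemma qcomm_gauged_X_C: "qcomm (-2) (gauged_X i) yC"
  using qcomm_gauged_X [of i 1 1 1] by (simp add: y_degree_parity)

lemma qcomm_gauged_X_A_mon: "qcomm (if even (i - j) then - 2 else 0) (gauged_X i) (A_mon j)"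
  using qcomm_gauged_X [of i 1 0 1] qcomm_gauged_X [of i 0 1 0] by (auto simp: A_mon_def y_degree_parity)

text \<open>Expand \<open>W_(i+1) W_i x_i\<close> once by the three-term relation and once by the
  product formula for \<open>W_(i+1) W_i\<close>. The multiples of \<open>x_i\<close> by
  \<open>A_i\<close> and \<open>A_(i+1)\<close> cancel, and \<open>A_i A_(i+1) = C\<close> remains.
  In contrast to the defining recursion, the coefficients are the same for all
  \<open>i\<close>.\<close>

lemma gauged_X_u_rec: "gauged_X (i + 2) = u1_elem * gauged_X i - yC * gauged_X (i - 2)"
proof -
  have "W_elem (i + 1) * (W_elem i * gauged_X i) = gauged_X (i + 2) + qh 1 * (A_mon (i + 1) * gauged_X i)
     + qh (-1) * (A_mon i * (gauged_X i + qh 1 * (A_mon (i + 1) * gauged_X (i - 2))))"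
    using W_elem_gauged_X [of "i + 1"] W_elem_gauged_X [of "i - 1"]
    by (simp add: W_elem_gauged_X distrib_left add.assoc qh_left_commute [of "W_elem _"] qh_mult_left 
       qcomm_left_commute [OF qcomm_W_elem_A_mon [of "i + 1" i]] del: qh_mult_cancel)
  moreover have "W_elem (i + 1) * (W_elem i * gauged_X i) = u1_elem * gauged_X i + qh (-1) * (A_mon i * gauged_X i) + qh 1 * (A_mon (i + 1) * gauged_X i)"
    by (simp add: mult.assoc [symmetric] W_elem_W_elem_down distrib_right)
  ultimately show ?thesis
    by (simp add: distrib_left qh_left_commute [of "A_mon _"] qh_mult_left A_mon_A_mon_left algebra_simps)
qed

lemma gauged_X_1: "gauged_X 1 = torus_X (1, 0, 0, 0, 0, 0)"
  and gauged_X_2: "gauged_X 2 = torus_X (0, 1, 0, 0, 0, 0)"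
  by (simp_all add: gauged_X_def)

lemma gauged_X_3: "gauged_X 3 = torus_X (0, 0, 1, 0, 0, 0)"
  using gauged_X_step_up [of 2] by (simp add: gauged_X_1 gauged_X_2 W_elem_def A_mon_def w_elem_def yX_def torus_norm)

lemma gauged_X_4: "gauged_X 4 = torus_X (-1, 1, 1, 0, 0, 0) + torus_X (-1, 0, 0, 1, 0, 0)"
  using gauged_X_step_up [of 3] by (simp add: gauged_X_2 gauged_X_3 W_elem_def A_mon_def z_elem_def yX_def torus_norm)

lemma gauged_X_0: "gauged_X 0 = torus_X (1, 1, -1, 0, 0, 0) + torus_X (0, 0, -1, 0, 0, -1)"
  using gauged_X_step_down [of 1] by (simp add: gauged_X_1 gauged_X_2 W_elem_def A_mon_inv_def z_elem_def yX_def torus_norm)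

lemma gauged_X_m1: "gauged_X (- 1) = torus_X (2, 0, - 1, 0, 0, 0) +
     (torus_X (1, - 1, - 1, 0, 0, - 1) + torus_X (0, - 1, 0, 0, - 1, - 1))"
  using gauged_X_step_down [of 0] by (simp add: gauged_X_1 gauged_X_0 W_elem_def A_mon_inv_def w_elem_def yX_def torus_norm)

text \<open>The defect \<open>D\<close> of this right-handed relation satisfies the recursion
  \<open>gauged_X_u_rec\<close>, since \<open>u_1\<close> and \<open>C\<close> commute with every
  \<open>A_i\<close>. It vanishes everywhere once it vanishes at enough initial values.\<close>

lemma gauged_X_W_elem: "gauged_X i * W_elem i = gauged_X (i + 1) + qh (-1) * (A_mon i * gauged_X (i - 1))"
proof -
  define D where "D i = gauged_X i * W_elem i - gauged_X (i + 1) - qh (-1) * (A_mon i * gauged_X (i - 1))" for i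
  have rec: "D (i + 2) = u1_elem * D i - yC * D (i - 2)" for i
  proof -
    have r: "gauged_X (i + 3) = u1_elem * gauged_X (i + 1) - yC * gauged_X (i - 1)"
      "gauged_X (i + 1) = u1_elem * gauged_X (i - 1) - yC * gauged_X (i - 3)"
      using gauged_X_u_rec [of "i + 1"] gauged_X_u_rec [of "i - 1"] by (simp_all add: algebra_simps)
    have "D (i + 2) = gauged_X (i + 2) * W_elem i - gauged_X (i + 3) - qh (-1) * (A_mon i * gauged_X (i + 1))"
      "D (i - 2) = gauged_X (i - 2) * W_elem i - gauged_X (i - 1) - qh (-1) * (A_mon i * gauged_X (i - 3))"
      by (simp_all add: D_def algebra_simps)
    then show ?thesis
      using qcomm_left_commute [OF qcomm_u1_A_mon, of i] qcomm_left_commute [OF qcomm_A_mon_C, of i]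
      by (simp add: D_def [of i] gauged_X_u_rec [of i] r qh_left_commute [of u1_elem] qh_left_commute [of yC] 
         left_diff_distrib right_diff_distrib mult.assoc)
  qed
  \<comment> \<open>The recursion has order two with step 2, so each parity class needs two zeros:
    the values at 0, 1, 2, 3 are computed explicitly. The downward step uses that \<open>C\<close>
    is a unit.\<close>
  have "D i = 0 \<and> D (i + 2) = 0" for i
  proof (induction i rule: int_two_step_induct [where k = 0])
    case base1
    show ?case by (simp add: D_def gauged_X_0 gauged_X_1 gauged_X_2 gauged_X_3 gauged_X_m1 W_elem_def A_mon_def yX_def w_elem_def torus_norm)
  next
    case base2
    show ?case by (simp add: D_def gauged_X_0 gauged_X_1 gauged_X_2 gauged_X_3 gauged_X_4 W_elem_def A_mon_def yX_def z_elem_def torus_norm)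
  next
    case (up i)
    then show ?case using rec [of "i + 2"] by (simp add: add.assoc)
  next
    case (down i)
    then have "yC * D i = yC * 0" using rec [of "i + 2"] by (simp add: add.assoc)
    then show ?case using down by (simp only: yX_mult_cancel)
  qed
  then show ?thesis by (simp add: D_def algebra_simps)
qed

text \<open>The mirror image of \<open>gauged_X_u_rec\<close>, from two expansions of
  \<open>x_i W_i W_(i+1)\<close>.\<close>

lemma gauged_X_u_rec_right: "gauged_X i * u1_elem = gauged_X (i + 2) + qh (-2) * (yC * gauged_X (i - 2))"
proof -
  have "gauged_X i * W_elem i * W_elem (i + 1) = gauged_X (i + 2) + qh (-1) * (A_mon (i + 1) * gauged_X i)
     + qh (-1) * (A_mon i * (gauged_X i + qh (-1) * (A_mon (i + 1) * gauged_X (i - 2))))"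
    using gauged_X_W_elem [of "i + 1"] gauged_X_W_elem [of "i - 1"]
    by (simp add: gauged_X_W_elem distrib_right add.assoc mult.assoc del: qh_mult_cancel)
  moreover have "gauged_X i * W_elem i * W_elem (i + 1) = gauged_X i * u1_elem + qh (-1) * (A_mon (i + 1) * gauged_X i) + qh (-1) * (A_mon i * gauged_X i)"
    using qcomm_gauged_X_A_mon [of i i] qcomm_gauged_X_A_mon [of i "i + 1"]
    by (simp add: mult.assoc W_elem_W_elem_up distrib_left qh_left_commute [of "gauged_X _"] qcomm_def qh_mult_left)
  ultimately show ?thesis
    by (simp add: distrib_left qh_left_commute [of "A_mon _"] qh_mult_left A_mon_A_mon_left algebra_simps)
qed

text \<open>Bracketing \<open>x_i W_i x_i\<close> in the two possible ways shows that the commutator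
  of \<open>x_(i+1)\<close> and \<open>x_i\<close> is a unit multiple of that of \<open>x_i\<close>
  and \<open>x_(i-1)\<close>. Hence its vanishing at the start spreads in both directions.\<close>

lemma gauged_X_commute_1: "gauged_X i * gauged_X (i + 1) = gauged_X (i + 1) * gauged_X i"
proof -
  have rec: "gauged_X (i + 1) * gauged_X i - gauged_X i * gauged_X (i + 1) =
      qh (-1) * (A_mon i * (gauged_X i * gauged_X (i - 1) - gauged_X (i - 1) * gauged_X i))" for i
  proof -
    have "gauged_X i * W_elem i * gauged_X i = gauged_X i * (W_elem i * gauged_X i)" by (simp add: mult.assoc)
    then show ?thesis
      using qcomm_left_commute [OF qcomm_gauged_X_A_mon [of i i]]
      by (simp add: gauged_X_W_elem W_elem_gauged_X distrib_left distrib_right mult.assoc qh_left_commute [of "gauged_X _"]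
        qh_mult_left right_diff_distrib) (simp add: algebra_simps)
  qed
  show ?thesis
  proof (induction i rule: int_induct [where k = 1])
    case base
    show ?case by (simp add: gauged_X_1 gauged_X_2 torus_norm)
  next
    case (step1 i)
    then show ?case using rec [of "i + 1"] by simp
  next
    case (step2 i)
    then have "qh (-1) * (A_mon i * (gauged_X i * gauged_X (i - 1) - gauged_X (i - 1) * gauged_X i)) = qh (-1) * (A_mon i * 0)"
      using rec [of i] by simp
    then show ?case by (simp only: qh_mult_cancel A_mon_mult_cancel) simp
  qed
qed

text \<open>The same argument with \<open>x_i u_1 x_i\<close>, which links the commutators at
  distance 2 within one parity class.\<close>

lemma gauged_X_commute_2: "gauged_X i * gauged_X (i + 2) = gauged_X (i + 2) * gauged_X i"
proof -
  have rec: "gauged_X (i + 2) * gauged_X i - gauged_X i * gauged_X (i + 2) =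
      qh (-2) * (yC * (gauged_X i * gauged_X (i - 2) - gauged_X (i - 2) * gauged_X i))" for i
  proof -
    have "gauged_X i * u1_elem * gauged_X i = gauged_X i * (u1_elem * gauged_X i)" by (simp add: mult.assoc)
    moreover have "u1_elem * gauged_X i = gauged_X (i + 2) + yC * gauged_X (i - 2)" by (simp add: gauged_X_u_rec)
    ultimately show ?thesis
      using qcomm_left_commute [OF qcomm_gauged_X_C [of i]]
      by (simp add: gauged_X_u_rec_right distrib_left distrib_right mult.assoc right_diff_distrib)
        (simp add: algebra_simps)
  qed
  show ?thesis
  proof (induction i rule: int_two_step_induct [where k = 0])
    case base1
    show ?case by (simp add: gauged_X_0 gauged_X_2 torus_norm)
  next
    case base2
    show ?case by (simp add: gauged_X_1 gauged_X_3 torus_norm)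
  next
    case (up i)
    then show ?case using rec [of "i + 2"] by simp
  next
    case (down i)
    then have "qh (-2) * (yC * (gauged_X (i + 2) * gauged_X i - gauged_X i * gauged_X (i + 2))) = qh (-2) * (yC * 0)"
      using rec [of "i + 2"] by simp
    then show ?case by (simp only: qh_mult_cancel yX_mult_cancel) simp
  qed
qed

section \<open>Exchange relations of the gauged sequence\<close>

lemma A_mon_R_mon: "A_mon (i + 1) * R_mon i = qh 1 * R_mon (i + 1)"
  by (cases "even i"; auto elim!: evenE oddE simp: A_mon_def R_mon_def yX_mult algebra_simps)

lemma R_mon_A_mon: "R_mon i * A_mon (i + 1) = qh (- 1) * R_mon (i + 1)"
  by (cases "even i"; auto elim!: evenE oddE simp: A_mon_def R_mon_def yX_mult algebra_simps)

lemma R_mon_C: "R_mon i * yC = qh (- 2) * R_mon (i + 2)"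
  by (cases "even i"; auto elim!: evenE oddE simp: A_mon_def R_mon_def yX_mult algebra_simps)

lemma qcomm_W_elem_R_mon: "qcomm 2 (W_elem i) (R_mon i)"
  unfolding R_mon_def by (rule qcomm_cong [OF qcomm_W_elem])
   (cases "even i"; auto elim!: evenE oddE)

lemma exchange_relation:
  "gauged_X i * gauged_X (i + 3) = gauged_X (i + 1) * gauged_X (i + 2) + qh (- 1) * R_mon i"
  "gauged_X (i + 3) * gauged_X i = gauged_X (i + 1) * gauged_X (i + 2) + qh 1 * R_mon i"
proof -
  have rec1: "gauged_X (i + 3) * gauged_X i - gauged_X (i + 1) * gauged_X (i + 2) =
      qh 1 * (A_mon i * (gauged_X (i - 1) * gauged_X (i + 2) - gauged_X i * gauged_X (i + 1)))" for i
  proof -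
    have "W_elem i * gauged_X i * gauged_X (i + 2) = W_elem (i + 2) * gauged_X (i + 2) * gauged_X i" 
      by (simp add: mult.assoc gauged_X_commute_2)
    then show ?thesis
      unfolding W_elem_gauged_X
      by (simp add: distrib_left distrib_right mult.assoc right_diff_distrib gauged_X_commute_1)
        (simp add: algebra_simps)
  qed
  have rec2: "gauged_X i * gauged_X (i + 3) - gauged_X (i + 1) * gauged_X (i + 2) =
      qh (-3) * (A_mon i * (gauged_X (i + 2) * gauged_X (i - 1) - gauged_X i * gauged_X (i + 1)))" for i
  proof -
    have "gauged_X i * (gauged_X (i + 2) * W_elem (i + 2)) = gauged_X (i + 2) * (gauged_X i * W_elem i)" 
      by (simp add: mult.assoc [symmetric] gauged_X_commute_2)
    then show ?thesis
      unfolding gauged_X_W_elem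
      using qcomm_left_commute [OF qcomm_gauged_X_A_mon [of i i]] qcomm_left_commute [OF qcomm_gauged_X_A_mon [of "i + 2" i]]
        gauged_X_commute_1 [of "i + 1"]
      by (simp add: distrib_left distrib_right mult.assoc right_diff_distrib qh_left_commute [of "gauged_X _"]
        qh_mult_left)
        (simp add: algebra_simps)
  qed
  have "gauged_X i * gauged_X (i + 3) - gauged_X (i + 1) * gauged_X (i + 2) = qh (- 1) * R_mon i \<and>
    gauged_X (i + 3) * gauged_X i - gauged_X (i + 1) * gauged_X (i + 2) = qh 1 * R_mon i"
  proof (induction i rule: int_induct [where k = 1])
    case base
    show ?case by (simp add: gauged_X_1 gauged_X_2 gauged_X_3 gauged_X_4 R_mon_def yX_def torus_norm)
  next
    case (step1 i)
    then show ?case using rec1 [of "i + 1"] rec2 [of "i + 1"] A_mon_R_mon [of i]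
      by (simp add: qh_left_commute [of "A_mon _"] qh_mult_left add.assoc)
  next
    case (step2 i)
    have "qh 1 * (A_mon i * (gauged_X (i - 1) * gauged_X (i + 2) - gauged_X i * gauged_X (i + 1))) =
        qh 1 * (A_mon i * (qh (- 1) * R_mon (i - 1)))"
      "qh (-3) * (A_mon i * (gauged_X (i + 2) * gauged_X (i - 1) - gauged_X i * gauged_X (i + 1))) =
        qh (-3) * (A_mon i * (qh 1 * R_mon (i - 1)))"
      using step2 rec1 [of i] rec2 [of i] A_mon_R_mon [of "i - 1"]
      by (simp_all add: qh_left_commute [of "A_mon _"] qh_mult_left)
    then show ?case by (simp only: qh_mult_cancel A_mon_mult_cancel) (simp add: algebra_simps)
  qed
  then show "gauged_X i * gauged_X (i + 3) = gauged_X (i + 1) * gauged_X (i + 2) + qh (- 1) * R_mon i"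
  "gauged_X (i + 3) * gauged_X i = gauged_X (i + 1) * gauged_X (i + 2) + qh 1 * R_mon i"
    by (simp_all add: algebra_simps)
qed

lemma yX_unit: "yX a b c * yX (- a) (- b) (- c) = 1"
  by (simp add: yX_mult)

text \<open>If \<open>x\<^sub>i = 0\<close>, the two exchange relations differ by \<open>(h - h^(-1)) R\<^sub>i\<close>.\<close>

lemma gauged_X_nonzero: "gauged_X i \<noteq> 0"
proof
  assume "gauged_X i = 0"
  then have "qh (- 1) * R_mon i = qh 1 * R_mon i"
    using exchange_relation [of i] by (metis add_left_cancel mult_zero_left mult_zero_right)
  then have "qh (- 1) = qh 1"
    unfolding R_mon_def by (metis mult.assoc mult_1_right yX_unit)
  then show False by simp
qed

section \<open>Product formulas\<close>

definition q_sum :: "nat \<Rightarrow> quantum_torus" where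
  "q_sum l = (\<Sum>i\<le>l. qh (2 * int i))"

text \<open>\<open>g_sum (n + 2)\<close> is the sum of the theorem with top index \<open>n\<close>;
  the shift by two gives the empty sums for \<open>n = -2\<close> and \<open>n = -1\<close> the
  arguments 0 and 1. The factor \<open>q^(3l/2)\<close> is absent because
  \<open>y_1 y_2 y_3 = q^(-3/2) C\<close>.\<close>

fun g_sum :: "nat \<Rightarrow> quantum_torus" where
  "g_sum 0 = 0"
| "g_sum (Suc 0) = 0"
| "g_sum (Suc (Suc n)) = (\<Sum>l\<le>n div 2. q_sum l * u_elem (n - 2 * l) * yC ^ l)"

lemma q_sum_commute: "x * q_sum l = q_sum l * x"
  by (simp add: q_sum_def sum_distrib_left sum_distrib_right qh_commute [of x])

lemma q_sum_left_commute: "x * (q_sum l * y) = q_sum l * (x * y)"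
  by (metis mult.assoc q_sum_commute)

text \<open>The \<open>u_n\<close> are Chebyshev polynomials of the first kind in
  \<open>u_1\<close>, except that \<open>u_0\<close> is 1 instead of 2. The additional
  \<open>C\<close> at \<open>n = 0\<close> makes up for this.\<close>

lemma u_elem_rec:
  "u1_elem * u_elem (Suc n) = u_elem (Suc (Suc n)) + yC * u_elem n + (if n = 0 then yC else 0)"
  by (cases n) (simp_all add: yX_def power2_eq_square mult_2)

lemma u1_move: "u1_elem * (q_sum l * x * y) = q_sum l * (u1_elem * x) * y"
  by (simp add: mult.assoc q_sum_left_commute [of u1_elem])

text \<open>Multiply the sum by \<open>u_1\<close> term by term and apply \<open>u_elem_rec\<close>.
  Only the last summand behaves irregularly: it contains \<open>u_0\<close> for odd \<open>k\<close>
  and \<open>u_1\<close> for even \<open>k > 0\<close>, and in the latter case it leaves the stated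
  correction.\<close>

lemma g_sum_rec:
  "u1_elem * g_sum (Suc k) =
    yC * g_sum k + g_sum (Suc (Suc k)) - (if even k then qh (int k) * yC ^ (k div 2) else 0)"
proof (cases k)
  case 0
  then show ?thesis by (simp add: q_sum_def)
next
  case (Suc m)
  show ?thesis
  proof (cases "even m")
    case True
    then obtain p where m: "m = 2 * p" by (elim evenE)
    have *: "q_sum l * (yC * x) * yC ^ l = yC * (q_sum l * x * yC ^ l)" for l x
      by (simp add: mult.assoc q_sum_left_commute [of yC])
    show ?thesis
    proof (cases p)
      case 0
      with Suc m show ?thesis by (simp add: q_sum_def)
    next
      case (Suc r)
      have "u1_elem * (q_sum l * u_elem (2 * p - 2 * l) * yC ^ l) =
         q_sum l * u_elem (Suc (2 * p) - 2 * l) * yC ^ l + yC * (q_sum l * u_elem (Suc (2 * r) - 2 * l) * yC ^ l)"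
        if "l \<le> r" for l
      proof -
        have "2 * p - 2 * l = Suc (Suc (2 * (r - l)))" 
          "Suc (2 * p) - 2 * l = Suc (Suc (Suc (2 * (r - l))))"
          "Suc (2 * r) - 2 * l = Suc (2 * (r - l))"
          using that Suc by linarith+
        then show ?thesis
          by (simp only: u1_move u_elem_rec)
            (simp add: mult.assoc q_sum_left_commute [of yC] distrib_left distrib_right)
      qed
      then have "u1_elem * (\<Sum>l\<le>r. q_sum l * u_elem (2 * p - 2 * l) * yC ^ l) =
        (\<Sum>l\<le>r. q_sum l * u_elem (Suc (2 * p) - 2 * l) * yC ^ l) + 
         yC * (\<Sum>l\<le>r. q_sum l * u_elem (Suc (2 * r) - 2 * l) * yC ^ l)"
        unfolding sum_distrib_left sum.distrib [symmetric] by (intro sum.cong) auto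
      \<comment> \<open>The last summand contains \<open>u_0 = 1\<close>, and
        \<open>u_1 u_0 = u_1\<close> contributes nothing to the multiple of
        \<open>C\<close>.\<close>
      moreover have "u1_elem * (q_sum p * u_elem (2 * p - 2 * p) * yC ^ p) = q_sum p * u_elem (Suc (2 * p) - 2 * p) * yC ^ p"
        using Suc by (simp add: mult.assoc q_sum_left_commute [of u1_elem])
      ultimately show ?thesis
        using \<open>k = Suc m\<close> m Suc by (simp add: distrib_left sum.atMost_Suc del: power_Suc)
    qed
  next
    case False
    then obtain p where m: "m = Suc (2 * p)" by (elim oddE) auto
    have step: "u1_elem * (q_sum l * u_elem (Suc (2 * p) - 2 * l) * yC ^ l) =
       q_sum l * u_elem (2 * Suc p - 2 * l) * yC ^ l + yC * (q_sum l * u_elem (2 * p - 2 * l) * yC ^ l)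
        + (if l = p then q_sum p * yC ^ Suc p else 0)"
      if "l \<le> p" for l
    proof -
      have "Suc (2 * p) - 2 * l = Suc (2 * (p - l))" 
        "2 * Suc p - 2 * l = Suc (Suc (2 * (p - l)))"
        "2 * p - 2 * l = 2 * (p - l)"
        using that by auto
      moreover have "p - l = 0 \<longleftrightarrow> l = p" using that by auto
      ultimately show ?thesis
        by (simp only: u1_move u_elem_rec)
          (simp add: mult.assoc q_sum_left_commute [of yC] distrib_left distrib_right)
    qed
    have "u1_elem * (\<Sum>l\<le>p. q_sum l * u_elem (Suc (2 * p) - 2 * l) * yC ^ l) =
      (\<Sum>l\<le>p. q_sum l * u_elem (2 * Suc p - 2 * l) * yC ^ l) + 
       yC * (\<Sum>l\<le>p. q_sum l * u_elem (2 * p - 2 * l) * yC ^ l) + q_sum p * yC ^ Suc p"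
    proof -
      have "(\<Sum>l\<le>p. if l = p then q_sum p * yC ^ Suc p else 0) = q_sum p * yC ^ Suc p" by simp
      moreover have "u1_elem * (\<Sum>l\<le>p. q_sum l * u_elem (Suc (2 * p) - 2 * l) * yC ^ l) =
        (\<Sum>l\<le>p. q_sum l * u_elem (2 * Suc p - 2 * l) * yC ^ l) +
         yC * (\<Sum>l\<le>p. q_sum l * u_elem (2 * p - 2 * l) * yC ^ l) +
         (\<Sum>l\<le>p. if l = p then q_sum p * yC ^ Suc p else 0)"
        by (simp only: sum_distrib_left sum.distrib [symmetric]) (intro sum.cong refl step, simp)
      ultimately show ?thesis by simp
    qed
    \<comment> \<open>The additional \<open>C\<close> in \<open>u_1 u_1\<close> supplies
      \<open>q_sum p\<close> as coefficient of \<open>C^(p+1)\<close>, but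
      \<open>g_sum (Suc (Suc k))\<close> needs \<open>q_sum (Suc p)\<close>; the difference
      \<open>q^(p+1)\<close> is the correction.\<close>
    moreover have "q_sum (Suc p) = q_sum p + qh (2 + 2 * int p)"
      by (simp add: q_sum_def add.commute)
    ultimately show ?thesis
      using Suc m by (simp add: distrib_left distrib_right del: power_Suc)
  qed
qed

section \<open>Left multiplication by W_i in the product formulas\<close>

lemma R_mon_shift: "R_mon (i + 2 * int p) = qh (2 * int p) * (R_mon i * yC ^ p)"
proof (induction p)
  case (Suc p)
  have "R_mon (i + 2 * int (Suc p)) = qh 2 * (R_mon (i + 2 * int p) * yC)"
    by (simp add: R_mon_C qh_mult_left algebra_simps)
  then show ?case
    by (simp add: Suc.IH mult.assoc qh_mult_left power_commutes [symmetric] distrib_left add.commute)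
qed simp

lemma W_elem_R_mon_left: "W_elem i * (R_mon i * x) = qh 2 * (R_mon i * (W_elem i * x))"
  by (rule qcomm_left_commute [OF qcomm_W_elem_R_mon])

lemma A_mon_R_mon_left: "A_mon (i + 1) * (R_mon i * x) = qh 1 * (R_mon (i + 1) * x)"
  "A_mon i * (R_mon (i - 1) * x) = qh 1 * (R_mon i * x)"
  using A_mon_R_mon [of i] A_mon_R_mon [of "i - 1"] by (simp_all add: mult.assoc [symmetric])

lemma R_mon_A_mon_left: "R_mon (i + 1) * x = qh 1 * (R_mon i * (A_mon (i + 1) * x))"
  using R_mon_A_mon [of i] by (simp add: mult.assoc [symmetric]) (simp add: mult.assoc qh_mult_left)

text \<open>Left multiplication by \<open>W_(i+1)\<close> splits \<open>x_(i+1) x_j\<close> into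
  \<open>x_(i+2) x_j\<close> and a unit multiple of \<open>x_i x_j\<close>. Thus the two products
  with larger left index determine \<open>x_i x_j\<close>.\<close>

lemma product_step_cancel:
  assumes "W_elem (i + 1) * (gauged_X (i + 1) * gauged_X j) - gauged_X (i + 2) * gauged_X j = qh 1 * (A_mon (i + 1) * z)"
  shows "gauged_X i * gauged_X j = z"
proof -
  have "W_elem (i + 1) * (gauged_X (i + 1) * gauged_X j) = gauged_X (i + 2) * gauged_X j + qh 1 * (A_mon (i + 1) * (gauged_X i * gauged_X j))"
    using W_elem_gauged_X [of "i + 1"] by (simp add: mult.assoc [symmetric] add.commute [of 2]) (simp add: distrib_right mult.assoc add.assoc)
  with assms have "qh 1 * (A_mon (i + 1) * (gauged_X i * gauged_X j)) = qh 1 * (A_mon (i + 1) * z)" by simp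
  then show ?thesis by (simp only: qh_mult_cancel A_mon_mult_cancel)
qed

lemma parity_shift_even [simp]: "W_elem (i + 2 * j) = W_elem i" "A_mon (i + 2 * j) = A_mon i"
  by (simp_all add: W_elem_def A_mon_def)

lemma W_elem_gauged_X_left:
  "W_elem i * (gauged_X (i + 2 * j) * y) = gauged_X (i + 2 * j + 1) * y + qh 1 * (A_mon i * (gauged_X (i + 2 * j - 1) * y))"
  using W_elem_gauged_X [of "i + 2 * j"] by (simp add: mult.assoc [symmetric]) (simp add: distrib_right mult.assoc)

text \<open>\<open>W_i\<close> is applied to the factor whose index has the parity of
  \<open>i\<close>. For odd \<open>n\<close> this is the second one, which is first moved to the
  front by commutation of near neighbours.\<close>

lemma lead_odd:
  "W_elem i * (gauged_X (i + int n) * gauged_X (i + int n + 1)) =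
    gauged_X (i + 1 + 2 * int (n div 2)) * gauged_X (i + 1 + 2 * int ((n + 1) div 2)) +
    qh 1 * (A_mon i * (gauged_X (i - 1 + 2 * int ((n + 1) div 2)) * gauged_X (i - 1 + 2 * int ((n + 2) div 2))))"
proof (cases "even n")
  case True
  then obtain p where n: "n = 2 * p" by (elim evenE)
  show ?thesis unfolding n
    using W_elem_gauged_X_left [of i "int p"] by (simp add: algebra_simps)
next
  case False
  then obtain p where n: "n = 2 * p + 1" by (elim oddE)
  define j where "j = i + 2 * int p + 1"
  have "gauged_X (j + 1) * gauged_X j = gauged_X j * gauged_X (j + 1)" "gauged_X (j + 2) * gauged_X j = gauged_X j * gauged_X (j + 2)"
    by (simp_all add: gauged_X_commute_1 gauged_X_commute_2)
  moreover have "W_elem i * (gauged_X (j + 1) * gauged_X j) = gauged_X (j + 2) * gauged_X j + qh 1 * (A_mon i * (gauged_X j * gauged_X j))"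
    using W_elem_gauged_X_left [of i "int p + 1"] by (simp add: j_def algebra_simps)
  ultimately show ?thesis unfolding n by (simp add: j_def algebra_simps)
qed

text \<open>For odd \<open>n\<close> the two factors coincide. For even \<open>n\<close> a product
  at distance 3 arises, and the exchange relation turns it into the expected one at the cost of a
  frozen monomial.\<close>

lemma lead_even:
  "W_elem i * (gauged_X (i + 2 * int ((n + 1) div 2)) * gauged_X (i + 2 * int ((n + 2) div 2))) =
    gauged_X (i + int n + 1) * gauged_X (i + int n + 2) +
    qh 1 * (A_mon i * (gauged_X (i + int n) * gauged_X (i + int n + 1))) +
    (if even n then A_mon i * R_mon (i + int n - 1) else 0)"
proof (cases "even n")
  case True
  then obtain p where n: "n = 2 * p" by (elim evenE)
  define j where "j = i + 2 * int p"
  have "W_elem i * (gauged_X j * gauged_X (j + 2)) = gauged_X (j + 1) * gauged_X (j + 2) + qh 1 * (A_mon i * (gauged_X (j - 1) * gauged_X (j + 2)))"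
    using W_elem_gauged_X_left [of i "int p"] by (simp add: j_def algebra_simps)
  moreover have "gauged_X (j - 1) * gauged_X (j + 2) = gauged_X j * gauged_X (j + 1) + qh (- 1) * R_mon (j - 1)"
    using exchange_relation(1) [of "j - 1"] by (simp add: algebra_simps)
  ultimately show ?thesis unfolding n
    by (simp add: j_def algebra_simps qh_left_commute [of "A_mon _"] qh_mult_left)
next
  case False
  then obtain p where n: "n = 2 * p + 1" by (elim oddE)
  define j where "j = i + 2 * int p + 2"
  have "gauged_X (j + 1) * gauged_X j = gauged_X j * gauged_X (j + 1)"
    by (simp add: gauged_X_commute_1)
  moreover have "W_elem i * (gauged_X j * gauged_X j) = gauged_X (j + 1) * gauged_X j + qh 1 * (A_mon i * (gauged_X (j - 1) * gauged_X j))"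
    using W_elem_gauged_X_left [of i "int p + 1"] by (simp add: j_def algebra_simps)
  ultimately show ?thesis unfolding n by (simp add: j_def algebra_simps)
qed

lemma tail_odd:
  "W_elem i * (qh (- 1) * (R_mon i * (x + qh 1 * (A_mon (i + 1) * y)))) =
    qh (- 1) * (R_mon (i + 1) * (W_elem i * y)) + qh 1 * (A_mon i * (qh (- 1) * (R_mon (i - 1) * (W_elem i * x))))"
  by (simp add: distrib_left qh_left_commute [of "W_elem _"] qh_left_commute [of "A_mon _"]
    qh_left_commute [of "R_mon _"] qh_mult_left W_elem_R_mon_left A_mon_R_mon_left R_mon_A_mon_left [of i]
    qcomm_left_commute [OF qcomm_W_elem_A_mon [of i "i + 1"]])

lemma W_elem_W_elem_left: "W_elem i * (W_elem (i + 1) * x) = u1_elem * x + qh (-1) * (A_mon (i + 1) * x) + qh 1 * (A_mon i * x)"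
  using W_elem_W_elem_up [of i] by (simp add: mult.assoc [symmetric]) (simp add: distrib_right mult.assoc)

lemma tail_even:
  "W_elem i * (qh (- 1) * (R_mon i * (W_elem (i + 1) * g_sum (Suc n)))) + (if even n then A_mon i * R_mon (i + int n - 1) else 0) =
    qh (- 1) * (R_mon (i + 1) * (g_sum (Suc n) + qh 1 * (A_mon i * g_sum n))) +
    qh 1 * (A_mon i * (qh (- 1) * (R_mon (i - 1) * (g_sum (Suc (Suc n)) + qh 1 * (A_mon i * g_sum (Suc n))))))"
proof -
  have "(if even n then A_mon i * R_mon (i + int n - 1) else 0) =
    qh 1 * (R_mon i * (if even n then qh (int n) * yC ^ (n div 2) else 0))"
  proof (cases "even n")
    case True
    then obtain p where n: "n = 2 * p" by (elim evenE)
    have "A_mon i * R_mon (i + int n - 1) = qh 1 * R_mon (i + 2 * int p)"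
      using A_mon_R_mon [of "i + int n - 1"] parity_shift_even(2) [of i "int p"] by (simp add: n algebra_simps)
    then show ?thesis by (simp add: R_mon_shift n qh_left_commute [of "R_mon _"])
  qed simp
  then show ?thesis
    by (simp add: distrib_left qh_left_commute [of "W_elem _"] qh_left_commute [of "A_mon _"]
    qh_left_commute [of "R_mon _"] qh_mult_left W_elem_R_mon_left A_mon_R_mon_left R_mon_A_mon_left [of i] A_mon_A_mon_left
    W_elem_W_elem_left g_sum_rec right_diff_distrib del: g_sum.simps)
qed

text \<open>Here \<open>p\<close> and \<open>r\<close> are the two shorter products, split into
  leading terms \<open>e'\<close>, \<open>e''\<close> and corrections \<open>t'\<close>,
  \<open>t''\<close>; \<open>x\<close> and \<open>y\<close> stand for \<open>W\<close> and
  \<open>A\<close>. The monomial \<open>k\<close> is produced by the leading term and consumed by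
  the correction.\<close>

lemma step_combine:
  assumes "p = e' + t'" "r = e'' + t''" "x * t' + k = t'' + qh 1 * (y * t)"
    "x * e' = e'' + qh 1 * (y * e) + k"
  shows "x * p - r = qh 1 * (y * (e + t))"
  using assms by (simp add: algebra_simps)

text \<open>Simultaneous induction on \<open>n\<close> for all \<open>i\<close>: the product
  starting at \<open>i\<close> is obtained from those starting at \<open>i + 1\<close> and
  \<open>i + 2\<close> with the same right end. The even formula for \<open>Suc n\<close> uses both
  formulas for \<open>n\<close>; the odd one uses the even formula for \<open>Suc n\<close> and the
  odd one for \<open>n\<close>.\<close>

lemma product_formulas:
  "gauged_X i * gauged_X (i + 2 * int n) = gauged_X (i + 2 * int (n div 2)) * gauged_X (i + 2 * int ((n + 1) div 2))
     + qh (- 1) * (R_mon i * (W_elem (i + 1) * g_sum n))" (is "?even n i")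
  "gauged_X i * gauged_X (i + 2 * int n + 1) = gauged_X (i + int n) * gauged_X (i + int n + 1)
     + qh (- 1) * (R_mon i * (g_sum (Suc n) + qh 1 * (A_mon (i + 1) * g_sum n)))" (is "?odd n i")
proof -
  have "(\<forall>i. ?even n i) \<and> (\<forall>i. ?odd n i)"
  proof (induction n)
    case 0
    show ?case by simp
  next
    case (Suc n)
    have even: "?even (Suc n) i" for i
    proof (rule product_step_cancel)
      have 1: "gauged_X (i + 1) * gauged_X (i + 2 * int (Suc n)) = gauged_X (i + 1 + int n) * gauged_X (i + 1 + int n + 1)
         + qh (- 1) * (R_mon (i + 1) * (g_sum (Suc n) + qh 1 * (A_mon (i + 1 + 1) * g_sum n)))"
        using Suc[THEN conjunct2, THEN spec, of "i + 1"] by (simp add: algebra_simps)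
      have 2: "gauged_X (i + 2) * gauged_X (i + 2 * int (Suc n)) =
          gauged_X (i + 1 + 1 + 2 * int (n div 2)) * gauged_X (i + 1 + 1 + 2 * int ((n + 1) div 2))
         + qh (- 1) * (R_mon (i + 1 + 1) * (W_elem (i + 1) * g_sum n))"
        using Suc[THEN conjunct1, THEN spec, of "i + 2"] by (simp add: algebra_simps)
      \<comment> \<open>The summand 0 takes the place of the exceptional monomial in
        \<open>step_combine\<close>; none occurs in this parity.\<close>
      have 3: "W_elem (i + 1) * (qh (- 1) * (R_mon (i + 1) * (g_sum (Suc n) + qh 1 * (A_mon (i + 1 + 1) * g_sum n)))) + 0 =
         qh (- 1) * (R_mon (i + 1 + 1) * (W_elem (i + 1) * g_sum n)) +
         qh 1 * (A_mon (i + 1) * (qh (- 1) * (R_mon (i + 1 - 1) * (W_elem (i + 1) * g_sum (Suc n)))))"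
        using tail_odd [of "i + 1"] by (simp only: add_0_right)
      show "W_elem (i + 1) * (gauged_X (i + 1) * gauged_X (i + 2 * int (Suc n))) - gauged_X (i + 2) * gauged_X (i + 2 * int (Suc n))
        = qh 1 * (A_mon (i + 1) * (gauged_X (i + 2 * int (Suc n div 2)) * gauged_X (i + 2 * int ((Suc n + 1) div 2)) +
             qh (- 1) * (R_mon i * (W_elem (i + 1) * g_sum (Suc n)))))"
        using step_combine [OF 1 2 3, OF trans [OF lead_odd [of "i + 1" n] add_0_right [symmetric]]]
        by (simp only: add_diff_cancel_right' Suc_eq_plus1 add.assoc [of n] one_add_one)
    qed
    have odd: "?odd (Suc n) i" for i
    proof (rule product_step_cancel)
      have 1: "gauged_X (i + 1) * gauged_X (i + 2 * int (Suc n) + 1) =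
           gauged_X (i + 1 + 2 * int ((n + 1) div 2)) * gauged_X (i + 1 + 2 * int ((n + 2) div 2))
         + qh (- 1) * (R_mon (i + 1) * (W_elem (i + 1 + 1) * g_sum (Suc n)))"
        using even [of "i + 1"] by (simp add: algebra_simps)
      have 2: "gauged_X (i + 2) * gauged_X (i + 2 * int (Suc n) + 1) =
        gauged_X (i + 1 + int n + 1) * gauged_X (i + 1 + int n + 2)
         + qh (- 1) * (R_mon (i + 1 + 1) * (g_sum (Suc n) + qh 1 * (A_mon (i + 1) * g_sum n)))"
        using Suc[THEN conjunct2, THEN spec, of "i + 2"] by (simp add: algebra_simps)
      note step_combine [OF 1 2 tail_even [of "i + 1" n] lead_even [of "i + 1" n]]
      moreover have "i + 1 + int n = i + int (Suc n)" by simp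
      ultimately show "W_elem (i + 1) * (gauged_X (i + 1) * gauged_X (i + 2 * int (Suc n) + 1)) - gauged_X (i + 2) * gauged_X (i + 2 * int (Suc n) + 1)
        = qh 1 * (A_mon (i + 1) * (gauged_X (i + int (Suc n)) * gauged_X (i + int (Suc n) + 1) +
             qh (- 1) * (R_mon i * (g_sum (Suc (Suc n)) + qh 1 * (A_mon (i + 1) * g_sum (Suc n))))))"
        by (simp only: add_diff_cancel_right')
    qed
    show ?case using even odd by blast
  qed
  then show "?even n i" "?odd n i" by blast+
qed

section \<open>Seeds\<close>

text \<open>All seeds \<open>\<Sigma>\<^sub>m\<close> share the principal part of the exchange matrix, and their cluster variables
  commute; \<open>l i t\<close> is the degree of the \<open>i\<close>-th one with respect to \<open>y\<^sub>t\<^sub>-\<^sub>3\<close> and \<open>c i\<close> the \<open>i\<close>-th column of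
  the frozen rows.\<close>

definition standard_seed ::
    "(quantum_torus \<Rightarrow> 'f :: division_ring) \<Rightarrow> (nat \<Rightarrow> nat \<Rightarrow> int) \<Rightarrow> (nat \<Rightarrow> nat \<Rightarrow> int) \<Rightarrow> (nat \<Rightarrow> 'f) \<Rightarrow>
     'f quantum_seed \<Rightarrow> bool" where
  "standard_seed \<iota> l c x S \<longleftrightarrow>
    (\<forall>i\<in>{1, 2, 3}. \<forall>j\<in>{1, 2, 3}. seed_Lambda S i j = 0 \<and> seed_B S i j = B0 i j) \<and>
    (\<forall>i\<in>{1, 2, 3}. \<forall>t\<in>{4, 5, 6}.
       seed_Lambda S i t = l i t \<and> seed_Lambda S t i = - l i t \<and> seed_B S t i = c i t) \<and>
    (\<forall>s\<in>{4, 5, 6}. \<forall>t\<in>{4, 5, 6}. seed_Lambda S s t = lambda0 s t) \<and>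
    (\<forall>i\<in>{1, 2, 3}. seed_X S i = x i) \<and> (\<forall>t\<in>{4, 5, 6}. seed_X S t = \<iota> (torus_X (unit6 t)))"

lemma sum_1_6: "(\<Sum>i = 1..6. f i) = f 1 + f 2 + f 3 + f 4 + f 5 + f (6::nat)" for f :: "nat \<Rightarrow> int"
proof -
  have "{1..6::nat} = {1, 2, 3, 4, 5, 6}" by auto
  then show ?thesis by simp
qed

lemma sum_pairs_1_6: "(\<Sum>j = 1..6. \<Sum>i = 1..<j. f i j) =
   f 1 2 + f 1 3 + f 2 3 + f 1 4 + f 2 4 + f 3 4 + f 1 5 + f 2 5 + f 3 5 + f 4 5
   + f 1 6 + f 2 6 + f 3 6 + f 4 6 + f 5 (6::nat)" for f :: "nat \<Rightarrow> nat \<Rightarrow> int"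
proof -
  have "{1..<2::nat} = {1}" "{1..<3::nat} = {1, 2}" "{1..<4::nat} = {1, 2, 3}" "{1..<5::nat} = {1, 2, 3, 4}"
    "{1..<6::nat} = {1, 2, 3, 4, 5}" by auto
  then show ?thesis unfolding sum_1_6 by simp
qed

text \<open>The matrix \<open>mutation_E k\<close> differs from the identity in column
  \<open>k\<close> only, so only row and column \<open>k\<close> of the form change.\<close>

lemma seed_Lambda_mutate:
  assumes "k \<in> {1..6}" "i \<in> {1..6}" "j \<in> {1..6}"
  shows "seed_Lambda (mutate \<iota> k S) i j =
    (if i = k then
      (if j = k then (\<Sum>r = 1..6. \<Sum>s = 1..6. mutation_E k (seed_B S) r k * seed_Lambda S r s * mutation_E k (seed_B S) s k)
      else (\<Sum>r = 1..6. mutation_E k (seed_B S) r k * seed_Lambda S r j))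
     else if j = k then (\<Sum>s = 1..6. seed_Lambda S i s * mutation_E k (seed_B S) s k) else seed_Lambda S i j)"
proof -
  have *: "mutation_E k B r s = (if r = s then 1 else 0)" if "s \<noteq> k" for B r s
    using that by (simp add: mutation_E_def)
  show ?thesis using assms
    unfolding mutate_def Let_def quantum_seed.simps mult.assoc sum_distrib_left [symmetric]
    by (auto simp: * if_distrib [of "\<lambda>x. x * _"] if_distrib [of "\<lambda>x. _ * x"] sum.delta sum.delta'
      cong: if_cong)
qed

lemma standard_next_Lambda_B:
  assumes S: "standard_seed \<iota> l c x S" and c: "\<forall>t\<in>{4, 5, 6}. c 1 t \<ge> 0"
  shows "\<forall>i\<in>{1, 2, 3}. \<forall>j\<in>{1, 2, 3}. seed_Lambda (next_seed \<iota> S) i j = 0 \<and> seed_B (next_seed \<iota> S) i j = B0 i j"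
    "\<forall>i\<in>{1, 2, 3}. \<forall>t\<in>{4, 5, 6}. seed_Lambda (next_seed \<iota> S) i t = (if i = 3 then l 2 t + l 3 t - l 1 t else l (i + 1) t)
      \<and> seed_Lambda (next_seed \<iota> S) t i = - (if i = 3 then l 2 t + l 3 t - l 1 t else l (i + 1) t)
      \<and> seed_B (next_seed \<iota> S) t i = (if i = 3 then - c 1 t else c (i + 1) t + c 1 t)"
    "\<forall>s\<in>{4, 5, 6}. \<forall>t\<in>{4, 5, 6}. seed_Lambda (next_seed \<iota> S) s t = lambda0 s t"
proof -
  note f = S [unfolded standard_seed_def, simplified] 
  note c' = c [simplified]
  have mB: "seed_B (mutate \<iota> 1 S) i j = (if i = 1 \<or> j = 1 then - seed_B S i j
     else seed_B S i j + (\<bar>seed_B S i 1\<bar> * seed_B S 1 j + seed_B S i 1 * \<bar>seed_B S 1 j\<bar>) div 2)" for i j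
    by (simp add: mutate_def Let_def)
  show "\<forall>i\<in>{1, 2, 3}. \<forall>j\<in>{1, 2, 3}. seed_Lambda (next_seed \<iota> S) i j = 0 \<and> seed_B (next_seed \<iota> S) i j = B0 i j"
    "\<forall>i\<in>{1, 2, 3}. \<forall>t\<in>{4, 5, 6}. seed_Lambda (next_seed \<iota> S) i t = (if i = 3 then l 2 t + l 3 t - l 1 t else l (i + 1) t)
      \<and> seed_Lambda (next_seed \<iota> S) t i = - (if i = 3 then l 2 t + l 3 t - l 1 t else l (i + 1) t)
      \<and> seed_B (next_seed \<iota> S) t i = (if i = 3 then - c 1 t else c (i + 1) t + c 1 t)"
    "\<forall>s\<in>{4, 5, 6}. \<forall>t\<in>{4, 5, 6}. seed_Lambda (next_seed \<iota> S) s t = lambda0 s t"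
    by (simp_all add: next_seed_def reorder_def seed_Lambda_mutate sum_1_6 [simplified] mutation_E_def f c' B0_def
      mB [simplified] numeral_2_eq_2 [symmetric])
qed

lemma standard_prev_Lambda_B:
  fixes l c :: "nat \<Rightarrow> nat \<Rightarrow> int" and S :: "'f :: division_ring quantum_seed"
  defines "d \<equiv> \<lambda>t. max (- c 3 t) 0"
  defines "l' \<equiv> \<lambda>i t. if i = 1 then (\<Sum>s\<in>{4, 5, 6}. d s * lambda0 s t) - l 3 t else l (i - 1) t"
  defines "c' \<equiv> \<lambda>i t. if i = 1 then - c 3 t else c (i - 1) t - d t"
  assumes S: "standard_seed \<iota> l c x S"
    and orth: "(\<Sum>t\<in>{4, 5, 6}. d t * l 1 t) = 0" "(\<Sum>t\<in>{4, 5, 6}. d t * l 2 t) = 0"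
  shows "\<forall>i\<in>{1, 2, 3}. \<forall>j\<in>{1, 2, 3}. seed_Lambda (prev_seed \<iota> S) i j = 0 \<and> seed_B (prev_seed \<iota> S) i j = B0 i j"
    "\<forall>i\<in>{1, 2, 3}. \<forall>t\<in>{4, 5, 6}. seed_Lambda (prev_seed \<iota> S) i t = l' i t
      \<and> seed_Lambda (prev_seed \<iota> S) t i = - l' i t \<and> seed_B (prev_seed \<iota> S) t i = c' i t"
    "\<forall>s\<in>{4, 5, 6}. \<forall>t\<in>{4, 5, 6}. seed_Lambda (prev_seed \<iota> S) s t = lambda0 s t"
proof -
  note f = S [unfolded standard_seed_def, simplified] 
  note o = orth [simplified]
  have mB: "seed_B (mutate \<iota> 3 S) i j = (if i = 3 \<or> j = 3 then - seed_B S i j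
     else seed_B S i j + (\<bar>seed_B S i 3\<bar> * seed_B S 3 j + seed_B S i 3 * \<bar>seed_B S 3 j\<bar>) div 2)" for i j
    by (simp add: mutate_def Let_def)
  have d: "(x - \<bar>x\<bar>) div 2 = - max (- x) 0" for x :: int by auto
  show "\<forall>i\<in>{1, 2, 3}. \<forall>j\<in>{1, 2, 3}. seed_Lambda (prev_seed \<iota> S) i j = 0 \<and> seed_B (prev_seed \<iota> S) i j = B0 i j"
    using o
    by (simp add: prev_seed_def reorder_def seed_Lambda_mutate sum_1_6 [simplified] mutation_E_def f B0_def
      mB [simplified] d d_def lambda0_def algebra_simps)
  show  "\<forall>i\<in>{1, 2, 3}. \<forall>t\<in>{4, 5, 6}. seed_Lambda (prev_seed \<iota> S) i t = l' i t
      \<and> seed_Lambda (prev_seed \<iota> S) t i = - l' i t \<and> seed_B (prev_seed \<iota> S) t i = c' i t"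
    by (simp add: prev_seed_def reorder_def seed_Lambda_mutate sum_1_6 [simplified] mutation_E_def f B0_def
      mB [simplified] d d_def l'_def c'_def lambda0_def)
  show "\<forall>s\<in>{4, 5, 6}. \<forall>t\<in>{4, 5, 6}. seed_Lambda (prev_seed \<iota> S) s t = lambda0 s t"
    by (simp_all add: prev_seed_def reorder_def seed_Lambda_mutate sum_1_6 [simplified] mutation_E_def f)
qed

section \<open>Mutation of standard seeds inside the skew-field\<close>

locale torus_fractions =
  fixes \<iota> :: "quantum_torus \<Rightarrow> 'f :: division_ring"
  assumes fractions: "is_skew_field_of_fractions \<iota>"
begin

lemma one [simp]: "\<iota> 1 = 1" and add: "\<iota> (a + b) = \<iota> a + \<iota> b"
  and mult: "\<iota> (a * b) = \<iota> a * \<iota> b" and inj: "inj \<iota>"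
  and ex_fraction: "\<exists>a b. b \<noteq> 0 \<and> x = \<iota> a * inverse (\<iota> b)"
  using fractions by (auto simp: is_skew_field_of_fractions_def)

lemma zero [simp]: "\<iota> 0 = 0"
  using add [of 0 0] by simp

lemma eq_iff [simp]: "\<iota> a = \<iota> b \<longleftrightarrow> a = b"
  using inj by (simp add: inj_eq)

lemma eq_0_iff [simp]: "\<iota> a = 0 \<longleftrightarrow> a = 0"
  using eq_iff [of a 0] by simp

lemma diff: "\<iota> (a - b) = \<iota> a - \<iota> b"
  using add [of "a - b" b] by simp

lemma sum: "\<iota> (\<Sum>i\<in>A. f i) = (\<Sum>i\<in>A. \<iota> (f i))"
  by (induction A rule: infinite_finite_induct) (simp_all add: add)

lemma qh_central: "x * \<iota> (qh k) = \<iota> (qh k) * x"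
proof -
  obtain a b where x: "x = \<iota> a * inverse (\<iota> b)" using ex_fraction by blast
  have *: "\<iota> a * \<iota> (qh k) = \<iota> (qh k) * \<iota> a" for a
    by (simp add: mult [symmetric] qh_commute)
  have "inverse (\<iota> b) * \<iota> (qh k) = \<iota> (qh k) * inverse (\<iota> b)"
    by (rule mult_commute_imp_mult_inverse_commute) (rule *)
  then show ?thesis unfolding x by (metis * mult.assoc)
qed

lemma image_qh_mult_left: "\<iota> (qh j) * (\<iota> (qh k) * x) = \<iota> (qh (j + k)) * x"
  by (simp add: mult.assoc [symmetric] mult [symmetric] qh_mult)

lemma qh_left_central: "x * (\<iota> (qh k) * y) = \<iota> (qh k) * (x * y)"
  by (metis mult.assoc qh_central)

lemma y_powi:
  "\<iota> (torus_X (unit6 4)) powi a = \<iota> (yX a 0 0)"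
  "\<iota> (torus_X (unit6 5)) powi a = \<iota> (yX 0 a 0)"
  "\<iota> (torus_X (unit6 6)) powi a = \<iota> (yX 0 0 a)"
proof -
  have *: "\<iota> (g 1) powi a = \<iota> (g a)" if g: "\<And>a b. g a * g b = g (a + b)" "g 0 = 1" for g a
  proof -
    have p: "\<iota> (g 1) ^ n = \<iota> (g (int n))" for n
      by (induction n) (simp_all add: g mult [symmetric])
    have "\<iota> (g (- int n)) = inverse (\<iota> (g (int n)))" for n
      by (rule inverse_unique [symmetric]) (simp add: g mult [symmetric])
    with p show ?thesis
      by (cases a rule: int_cases2) (simp_all add: power_int_def power_inverse g)
  qed
  have u: "torus_X (unit6 4) = yX 1 0 0" "torus_X (unit6 5) = yX 0 1 0" "torus_X (unit6 6) = yX 0 0 1"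
    by (simp_all add: yX_def unit6_def vec6_def)
  show "\<iota> (torus_X (unit6 4)) powi a = \<iota> (yX a 0 0)"
    unfolding u by (rule * [of "\<lambda>a. yX a 0 0"]) (simp_all add: yX_mult)
  show "\<iota> (torus_X (unit6 5)) powi a = \<iota> (yX 0 a 0)"
    unfolding u by (rule * [of "\<lambda>a. yX 0 a 0"]) (simp_all add: yX_mult)
  show "\<iota> (torus_X (unit6 6)) powi a = \<iota> (yX 0 0 a)"
    unfolding u by (rule * [of "\<lambda>a. yX 0 0 a"]) (simp_all add: yX_mult)
qed

lemma seed_monomial_standard:
  assumes S: "standard_seed \<iota> l c x S"
  shows "seed_monomial \<iota> S e =
    \<iota> (qh (- (\<Sum>i\<in>{1, 2, 3}. \<Sum>t\<in>{4, 5, 6}. e i * l i t * e t))) *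
    (x 1 powi e 1 * (x 2 powi e 2 * (x 3 powi e 3 * \<iota> (yX (e 4) (e 5) (e 6)))))"
proof -
  note f = S [unfolded standard_seed_def, simplified] 
  define k where "k = (\<Sum>i\<in>{1, 2, 3}. \<Sum>t\<in>{4, 5, 6}. e i * l i t * e t)"
  define n where "n = e 4 * e 5 + e 4 * e 6 + e 5 * e 6"
  have "(\<Sum>j = 1..6. \<Sum>i = 1..<j. e i * e j * seed_Lambda S i j) = k - n"
    unfolding sum_pairs_1_6 by (simp add: f k_def n_def lambda0_def algebra_simps)
  moreover have "torus_q (- (1 / 2) * of_int (k - n)) = qh (n - k)"
    by (rule torus_q_half_int) (simp add: field_simps)
  moreover have "yX (e 4) 0 0 * (yX 0 (e 5) 0 * yX 0 0 (e 6)) = qh (- n) * yX (e 4) (e 5) (e 6)"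
    by (simp add: yX_mult qh_left_commute [of "yX _ _ _"] qh_mult_left n_def)
  moreover have "seed_X S i = x i" if "i \<in> {1, 2, 3}" for i
    using S that unfolding standard_seed_def by blast
  moreover have "seed_X S i = \<iota> (torus_X (unit6 i))" if "i \<in> {4, 5, 6}" for i
    using S that unfolding standard_seed_def by blast
  ultimately show ?thesis
    unfolding seed_monomial_def k_def [symmetric]
    by (simp add: mult.assoc y_powi mult [symmetric] del: eq_iff)
      (simp add: mult qh_left_central [of "_ powi _"] mult.assoc [symmetric, of "\<iota> (qh _)" "\<iota> (qh _)"], simp add: mult [symmetric] qh_mult)
qed

text \<open>The image of \<open>v 1\<close> is invertible, so the new variable can be identified
  after multiplying the mutation rule by it from the left; what remains is an identity in the
  quantum torus.\<close>

lemma standard_next: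
  fixes l c :: "nat \<Rightarrow> nat \<Rightarrow> int"
  assumes S: "standard_seed \<iota> l c (\<lambda>i. \<iota> (v i)) S" and c: "\<forall>t\<in>{4, 5, 6}. c 1 t \<ge> 0" and "v 1 \<noteq> 0"
    and v': "v 1 * v' = v 2 * v 3 + qh (\<Sum>t\<in>{4, 5, 6}. l 1 t * c 1 t) * yX (c 1 4) (c 1 5) (c 1 6)"
  shows "standard_seed \<iota> (\<lambda>i t. if i = 3 then l 2 t + l 3 t - l 1 t else l (i + 1) t)
    (\<lambda>i t. if i = 3 then - c 1 t else c (i + 1) t + c 1 t)
    (\<lambda>i. \<iota> (if i = 3 then v' else v (i + 1))) (next_seed \<iota> S)"
proof -
  note f = S [unfolded standard_seed_def, simplified]
  note c' = c [simplified]
  have "\<iota> (v 1) * (inverse (\<iota> (v 1)) * z) = z" for z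
    using \<open>v 1 \<noteq> 0\<close> by (simp add: mult.assoc [symmetric])
  then have "\<iota> (v 1) * seed_X (mutate \<iota> 1 S) 1 = \<iota> (v 1) * \<iota> v'"
    unfolding mult [symmetric] v'
    by (simp add: mutate_def Let_def seed_monomial_standard [OF S] f B0_def c' add mult distrib_left
      qh_left_central [of "\<iota> _"] add.commute add.left_commute)
  then have new: "seed_X (mutate \<iota> 1 S) 1 = \<iota> v'"
    using \<open>v 1 \<noteq> 0\<close> by simp
  have old: "seed_X (mutate \<iota> 1 S) i = seed_X S i" if "i \<noteq> 1" for i
    using that by (simp add: mutate_def Let_def)
  show ?thesis
    unfolding standard_seed_def
    by (intro conjI standard_next_Lambda_B [OF S c])
      (simp_all add: next_seed_def reorder_def new [simplified] old [simplified] f numeral_2_eq_2 [symmetric])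
qed

lemma standard_prev:
  fixes l c :: "nat \<Rightarrow> nat \<Rightarrow> int"
  defines "d \<equiv> \<lambda>t. max (- c 3 t) 0" and "p \<equiv> \<lambda>t. max (c 3 t) 0"
  assumes S: "standard_seed \<iota> l c (\<lambda>i. \<iota> (v i)) S"
    and orth: "(\<Sum>t\<in>{4, 5, 6}. d t * l 1 t) = 0" "(\<Sum>t\<in>{4, 5, 6}. d t * l 2 t) = 0" and "v 3 \<noteq> 0"
    and comm: "\<And>i a b c. i \<in> {1, 2, 3} \<Longrightarrow> qcomm (2 * (l i 4 * a + l i 5 * b + l i 6 * c)) (v i) (yX a b c)"
    and v': "v' * v 3 = qh (\<Sum>t\<in>{4, 5, 6}. (l 1 t + l 2 t - l 3 t) * p t) * (yX (p 4) (p 5) (p 6) * (v 1 * v 2))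
     + qh (- (\<Sum>t\<in>{4, 5, 6}. l 3 t * d t)) * yX (d 4) (d 5) (d 6)"
  shows "standard_seed \<iota> (\<lambda>i t. if i = 1 then (\<Sum>s\<in>{4, 5, 6}. d s * lambda0 s t) - l 3 t else l (i - 1) t)
    (\<lambda>i t. if i = 1 then - c 3 t else c (i - 1) t - d t)
    (\<lambda>i. \<iota> (if i = 1 then v' else v (i - 1))) (prev_seed \<iota> S)"
proof -
  note f = S [unfolded standard_seed_def, simplified]
  define L where "L i e = l i 4 * e 4 + l i 5 * e 5 + l i 6 * e 6" for i and e :: "nat \<Rightarrow> int"
  define Y where "Y e = yX (e 4) (e 5) (e 6)" for e :: "nat \<Rightarrow> int"
  have comm': "v i * Y e = qh (2 * L i e) * (Y e * v i)" if "i \<in> {1, 2, 3}" for i e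
    using comm [OF that, of "e 4" "e 5" "e 6"] by (simp add: qcomm_def L_def Y_def)
  have three: "3 \<in> {1, 2, 3::nat}" by simp
  have "Y e * v 3 = qh (- 2 * L 3 e) * (v 3 * Y e)" for e
    unfolding comm' [of 3, OF three] by (simp add: qh_mult_left)
  then have pass3: "\<iota> (Y e) * \<iota> (v 3) = \<iota> (qh (- 2 * L 3 e)) * (\<iota> (v 3) * \<iota> (Y e))" for e
    by (simp add: mult [symmetric])
  have cancel: "inverse (\<iota> (v 3)) * (\<iota> (v 3) * z) = z" for z
    using \<open>v 3 \<noteq> 0\<close> by (simp add: mult.assoc [symmetric])
  have pass12: "\<iota> (v 1) * (\<iota> (v 2) * \<iota> (Y e)) = \<iota> (qh (2 * (L 1 e + L 2 e))) * (\<iota> (Y e) * (\<iota> (v 1) * \<iota> (v 2)))" for e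
  proof -
    have "v 1 * (v 2 * Y e) = qh (2 * L 2 e) * ((v 1 * Y e) * v 2)"
      using comm' [of 2 e] qh_left_commute [of "v 1" "2 * L 2 e"] by (simp add: mult.assoc)
    also have "\<dots> = qh (2 * L 2 e) * (qh (2 * L 1 e) * (Y e * (v 1 * v 2)))"
      using comm' [of 1 e] by (simp add: mult.assoc)
    also have "\<dots> = qh (2 * (L 1 e + L 2 e)) * (Y e * (v 1 * v 2))"
      by (simp add: qh_mult_left algebra_simps)
    finally show ?thesis by (simp add: mult [symmetric])
  qed
  have "seed_X (mutate \<iota> 3 S) 3 =
    \<iota> (qh (L 3 p - L 1 p - L 2 p)) * (\<iota> (v 1) * (\<iota> (v 2) * (inverse (\<iota> (v 3)) * \<iota> (Y p)))) +
    \<iota> (qh (L 3 d)) * (inverse (\<iota> (v 3)) * \<iota> (Y d))"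
    by (simp add: mutate_def Let_def seed_monomial_standard [OF S] f B0_def L_def Y_def d_def p_def)
      (simp add: algebra_simps)
  then have "seed_X (mutate \<iota> 3 S) 3 * \<iota> (v 3) =
    \<iota> (qh (L 3 p - L 1 p - L 2 p)) * (\<iota> (v 1) * (\<iota> (v 2) * (inverse (\<iota> (v 3)) * (\<iota> (Y p) * \<iota> (v 3))))) +
    \<iota> (qh (L 3 d)) * (inverse (\<iota> (v 3)) * (\<iota> (Y d) * \<iota> (v 3)))"
    by (simp add: distrib_right mult.assoc)
  also have "\<dots> = \<iota> (qh (L 1 p + L 2 p - L 3 p)) * (\<iota> (Y p) * (\<iota> (v 1) * \<iota> (v 2))) + \<iota> (qh (- L 3 d)) * \<iota> (Y d)"
    by (simp add: pass3 cancel qh_left_central [of "\<iota> (v _)"] qh_left_central [of "inverse _"] image_qh_mult_left pass12 [simplified])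
  also have "\<dots> = \<iota> (v' * v 3)"
    unfolding v' by (simp add: L_def Y_def add mult algebra_simps)
  finally have "seed_X (mutate \<iota> 3 S) 3 * \<iota> (v 3) = \<iota> v' * \<iota> (v 3)"
    by (simp only: mult)
  then have new: "seed_X (mutate \<iota> 3 S) 3 = \<iota> v'"
    using \<open>v 3 \<noteq> 0\<close> by simp
  have old: "seed_X (mutate \<iota> 3 S) i = seed_X S i" if "i \<noteq> 3" for i
    using that by (simp add: mutate_def Let_def)
  show ?thesis
    unfolding standard_seed_def d_def
    by (intro conjI standard_prev_Lambda_B [OF S orth [unfolded d_def]])
      (simp_all add: prev_seed_def reorder_def new [simplified] old [simplified] f numeral_2_eq_2 [symmetric])
qed

end

section \<open>Rescaled variables at nonpositive indices\<close>

definition rho :: "int \<Rightarrow> nat \<Rightarrow> int" where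
  "rho m t = (if t = 4 then m div 2 + m mod 2 else if t = 5 then m div 2 else m div 2 - 1 + m mod 2)"

definition gauge :: "int \<Rightarrow> nat \<Rightarrow> int" where
  "gauge m t = (if m \<ge> 1 then 0 else rho m t)"

definition cluster_elem :: "int \<Rightarrow> quantum_torus" where
  "cluster_elem m = qh (if m \<ge> 1 then 0 else 1) * (yX (- gauge m 4) (- gauge m 5) (- gauge m 6) * gauged_X m)"

lemma R_mon_rho: "R_mon m = yX (rho m 4) (rho m 5) (rho m 6)"
  by (simp add: R_mon_def rho_def)

lemma cluster_elem_pos: "m \<ge> 1 \<Longrightarrow> cluster_elem m = gauged_X m"
  by (simp add: cluster_elem_def gauge_def)

lemma cluster_elem_nonpos: "m \<le> 0 \<Longrightarrow> cluster_elem m = qh 1 * (yX (- rho m 4) (- rho m 5) (- rho m 6) * gauged_X m)"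
  by (simp add: cluster_elem_def gauge_def)

lemma gauged_X_gauged: "m \<le> 0 \<Longrightarrow> gauged_X m = qh (- 1) * (R_mon m * cluster_elem m)"
  by (simp add: cluster_elem_nonpos R_mon_rho qh_left_commute [of "yX _ _ _"] qh_mult_left)

lemma cluster_elem_nonzero: "cluster_elem m \<noteq> 0"
  using gauged_X_nonzero [of m] gauged_X_gauged [of m] cluster_elem_pos [of m] by (cases "m \<ge> 1") auto

definition cluster_degree :: "int \<Rightarrow> nat \<Rightarrow> int" where
  "cluster_degree m t = (if m \<ge> 1 then
      if t = 4 then m div 2 - 1 else if t = 5 then m mod 2 - 1 else 1 - m div 2 - m mod 2
    else if t = 4 then - (m div 2) - m mod 2 else if t = 5 then m mod 2 else m div 2 + 1)"

lemma qcomm_mult_cong: "qcomm k x z \<Longrightarrow> qcomm l y z \<Longrightarrow> k + l = n \<Longrightarrow> qcomm n (x * y) z"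
  using qcomm_mult by blast

lemma qcomm_cluster_elem: "qcomm (2 * (cluster_degree m 4 * a + cluster_degree m 5 * b + cluster_degree m 6 * c)) (cluster_elem m) (yX a b c)"
proof -
  have "cluster_degree m 4 * a + cluster_degree m 5 * b + cluster_degree m 6 * c = 
    - (gauge m 5 * a - gauge m 4 * b + gauge m 6 * a - gauge m 4 * c + gauge m 6 * b - gauge m 5 * c) + y_degree m a b c"
    by (cases "even m"; auto elim!: evenE oddE simp: cluster_degree_def gauge_def rho_def y_degree_def algebra_simps)
  then show ?thesis unfolding cluster_elem_def
    by (intro qcomm_qh qcomm_mult_cong [OF qcomm_yX qcomm_gauged_X]) (simp add: algebra_simps)
qed

lemma gauge_mult: "(qh j * (yX a b c * gauged_X m)) * (qh k * (yX a' b' c' * x)) =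
    qh (j + k + 2 * y_degree m a' b' c' + (b * a' - a * b' + c * a' - a * c' + c * b' - b * c')) *
    (yX (a + a') (b + b') (c + c') * (gauged_X m * x))"
  using qcomm_left_commute [OF qcomm_gauged_X [of m a' b' c'], of x]
  by (simp add: mult.assoc qh_left_commute [of "gauged_X _"] qh_left_commute [of "yX _ _ _"] qh_mult_left
      yX_mult_left) (simp add: algebra_simps)

text \<open>Both rescaling monomials are collected on the left. The power of h comes from moving the
  second one past \<open>x_m\<close> and from merging the two.\<close>

lemma cluster_elem_mult: "cluster_elem m * cluster_elem n = qh ((if m \<ge> 1 then 0 else 1) + (if n \<ge> 1 then 0 else 1)
    - 2 * y_degree m (gauge n 4) (gauge n 5) (gauge n 6)
    + gauge m 5 * gauge n 4 - gauge m 4 * gauge n 5 + gauge m 6 * gauge n 4 - gauge m 4 * gauge n 6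
    + gauge m 6 * gauge n 5 - gauge m 5 * gauge n 6) *
   (yX (- gauge m 4 - gauge n 4) (- gauge m 5 - gauge n 5) (- gauge m 6 - gauge n 6) * (gauged_X m * gauged_X n))"
  unfolding cluster_elem_def gauge_mult
  by (intro arg_cong2 [where f = "(*)"] arg_cong [where f = qh] refl)
    (simp_all add: y_degree_def algebra_simps)

lemma cluster_elem_exchange_up:
  assumes "m \<ge> 1"
  shows "cluster_elem m * cluster_elem (m + 3) = cluster_elem (m + 1) * cluster_elem (m + 2) +
    qh (\<Sum>t\<in>{4, 5, 6}. cluster_degree m t * rho m t) * yX (rho m 4) (rho m 5) (rho m 6)"
proof -
  have "(\<Sum>t\<in>{4, 5, 6}. cluster_degree m t * rho m t) = - 1"
    using assms by (cases "even m"; auto elim!: evenE oddE simp: cluster_degree_def rho_def algebra_simps)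
  then show ?thesis
    using assms exchange_relation(1) [of m] by (simp add: cluster_elem_pos R_mon_rho)
qed

text \<open>The frozen rows of the exchange matrix of \<open>\<Sigma>\<^sub>m\<close>. The signs change between \<open>m = 0\<close> and \<open>m = - 2\<close>,
  which is where the mutation passes from the cluster variables \<open>x\<^sub>m\<close> to the rescaled ones.\<close>

definition column :: "int \<Rightarrow> nat \<Rightarrow> nat \<Rightarrow> int" where
  "column m i t =
    (let first = (\<lambda>m. if m \<ge> 0 then rho m t else if m = - 1 then if t = 5 then - 1 else 0 else - rho (m + 3) t);
         alt = (\<lambda>m. if t = 5 then if even m then 1 else 0 else if even m then 0 else 1)
     in if i = 1 then first m else if i = 3 then - first (m - 1)
     else if m \<ge> 1 then alt (m + 1) else if m = 0 then if t = 4 then 1 else 0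
       else if m = - 1 then if t = 6 then - 1 else 0 else - alt m)"

lemma odd_pred: "(2 * k - 1) div 2 = k - 1" "(2 * k - 1) mod 2 = 1"
  "(k * 2 - 1) div 2 = k - 1" "(k * 2 - 1) mod 2 = 1" for k :: int
  by presburger+

text \<open>The relation between the gauged elements with indices \<open>m - 1\<close> to
  \<open>m + 2\<close>, rescaled. For \<open>m = 1, 0, - 1\<close> these indices lie on both sides
  of the border between 0 and 1, and the exponents are computed one by one; for
  \<open>m \<le> - 2\<close> all four elements are rescaled and the argument is uniform.\<close>

lemma cluster_elem_exchange_down:
  assumes "m \<le> 1"
  shows "cluster_elem (m - 1) * cluster_elem (m + 2) =
     qh (\<Sum>t\<in>{4, 5, 6}. (cluster_degree m t + cluster_degree (m + 1) t - cluster_degree (m + 2) t) * max (column m 3 t) 0) *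
       (yX (max (column m 3 4) 0) (max (column m 3 5) 0) (max (column m 3 6) 0) * (cluster_elem m * cluster_elem (m + 1))) +
     qh (- (\<Sum>t\<in>{4, 5, 6}. cluster_degree (m + 2) t * max (- column m 3 t) 0)) *
       yX (max (- column m 3 4) 0) (max (- column m 3 5) 0) (max (- column m 3 6) 0)"
proof -
  have ex: "gauged_X (m - 1) * gauged_X (m + 2) = gauged_X m * gauged_X (m + 1) + qh (- 1) * R_mon (m - 1)"
    using exchange_relation(1) [of "m - 1"] by (simp add: algebra_simps)
  consider "m = 1" | "m = 0" | "m = - 1" | "m \<le> - 2" using assms by linarith
  then show ?thesis
  proof cases
    case 1
    then show ?thesis using ex
      by (simp add: cluster_elem_mult column_def cluster_degree_def gauge_def rho_def y_degree_def R_mon_rho distrib_left yX_mult qh_mult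
        qh_left_commute [of "yX _ _ _"] qh_mult_left)
  next
    case 2
    then show ?thesis using ex
      by (simp add: cluster_elem_mult column_def cluster_degree_def gauge_def rho_def y_degree_def R_mon_rho distrib_left yX_mult yX_mult_left
        qh_left_commute [of "yX _ _ _"] qh_mult_left qh_mult)
  next
    case 3
    then show ?thesis using ex
      by (simp add: cluster_elem_mult column_def cluster_degree_def gauge_def rho_def y_degree_def R_mon_rho distrib_left yX_mult yX_mult_left
        qh_left_commute [of "yX _ _ _"] qh_mult_left qh_mult)
  next
    case 4
    have col: "column m 3 t = rho (m + 2) t" for t
      using 4 by (simp add: column_def add.commute)
    have neg: "rho (m + 2) t \<le> 0" for t
      using 4 by (cases "even m"; auto elim!: evenE oddE simp: rho_def)
    have max: "max (column m 3 t) 0 = 0" "max (- column m 3 t) 0 = - rho (m + 2) t" for t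
      using neg [of t] by (simp_all add: col)
    have g: "gauge (m - 1) = rho (m - 1)" "gauge m = rho m" "gauge (m + 1) = rho (m + 1)"
      "gauge (m + 2) = rho (m + 2)" "\<not> 1 \<le> m - 1" "\<not> 1 \<le> m" "\<not> 1 \<le> m + 1" "\<not> 1 \<le> m + 2"
      using 4 by (auto simp: gauge_def fun_eq_iff)
    \<comment> \<open>Both products carry the same total rescaling, so the gauged relation is
      multiplied by one common factor; \<open>E\<close> is the matching statement for the powers of
      h.\<close>
    have v: "- rho (m - 1) t - rho (m + 2) t = - rho m t - rho (m + 1) t" for t
      by (cases "even m"; auto elim!: evenE oddE simp: rho_def odd_pred)
    define e where "e = 1 + 1 - 2 * y_degree m (rho (m + 1) 4) (rho (m + 1) 5) (rho (m + 1) 6)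
      + rho m 5 * rho (m + 1) 4 - rho m 4 * rho (m + 1) 5 + rho m 6 * rho (m + 1) 4 - rho m 4 * rho (m + 1) 6
      + rho m 6 * rho (m + 1) 5 - rho m 5 * rho (m + 1) 6"
    define Y where "Y = yX (- rho m 4 - rho (m + 1) 4) (- rho m 5 - rho (m + 1) 5) (- rho m 6 - rho (m + 1) 6)"
    have E: "1 + 1 - 2 * y_degree (m - 1) (rho (m + 2) 4) (rho (m + 2) 5) (rho (m + 2) 6)
      + rho (m - 1) 5 * rho (m + 2) 4 - rho (m - 1) 4 * rho (m + 2) 5 + rho (m - 1) 6 * rho (m + 2) 4
      - rho (m - 1) 4 * rho (m + 2) 6 + rho (m - 1) 6 * rho (m + 2) 5 - rho (m - 1) 5 * rho (m + 2) 6 = e"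
      unfolding e_def
      by (cases "even m"; auto elim!: evenE oddE simp: rho_def y_degree_def odd_pred algebra_simps)
    have "cluster_elem (m - 1) * cluster_elem (m + 2) = qh e * (Y * (gauged_X (m - 1) * gauged_X (m + 2)))"
      by (simp only: cluster_elem_mult g if_False E v Y_def)
    then have 1: "cluster_elem (m - 1) * cluster_elem (m + 2) = qh e * (Y * (gauged_X m * gauged_X (m + 1))) + qh (e - 1) * (Y * R_mon (m - 1))"
      by (simp add: ex Y_def distrib_left qh_left_commute [of "yX _ _ _"] qh_mult_left)
    have 2: "cluster_elem m * cluster_elem (m + 1) = qh e * (Y * (gauged_X m * gauged_X (m + 1)))"
      by (simp only: cluster_elem_mult g if_False Y_def e_def)
    have S: "(\<Sum>t\<in>{4, 5, 6}. cluster_degree (m + 2) t * rho (m + 2) t) = e - 1 +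
     (- (rho m 5 + rho (m + 1) 5) * rho (m - 1) 4 + (rho m 4 + rho (m + 1) 4) * rho (m - 1) 5 
      - (rho m 6 + rho (m + 1) 6) * rho (m - 1) 4 + (rho m 4 + rho (m + 1) 4) * rho (m - 1) 6
      - (rho m 6 + rho (m + 1) 6) * rho (m - 1) 5 + (rho m 5 + rho (m + 1) 5) * rho (m - 1) 6)"
      using 4 unfolding e_def
      by (cases "even m"; auto elim!: evenE oddE simp: rho_def y_degree_def cluster_degree_def odd_pred algebra_simps)
    have v': "- rho m t - rho (m + 1) t + rho (m - 1) t = - rho (m + 2) t" for t
      using v [of t] by simp
    have 3: "qh (e - 1) * (Y * R_mon (m - 1)) =
       qh (\<Sum>t\<in>{4, 5, 6}. cluster_degree (m + 2) t * rho (m + 2) t) * yX (- rho (m + 2) 4) (- rho (m + 2) 5) (- rho (m + 2) 6)"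
      unfolding Y_def R_mon_rho yX_mult qh_mult_left v' S
      by (intro arg_cong2 [where f = "(*)"] arg_cong [where f = qh] refl) (simp add: algebra_simps)
    show ?thesis unfolding max 1 2 3 by (simp add: algebra_simps)
  qed
qed

section \<open>Identification of the seeds of the sequence\<close>

lemma standard_seed_cong:
  assumes "standard_seed \<iota> l c x S"
    and "\<And>i t. i \<in> {1, 2, 3} \<Longrightarrow> t \<in> {4, 5, 6} \<Longrightarrow> l i t = l' i t"
    and "\<And>i t. i \<in> {1, 2, 3} \<Longrightarrow> t \<in> {4, 5, 6} \<Longrightarrow> c i t = c' i t"
    and "\<And>i. i \<in> {1, 2, 3} \<Longrightarrow> x i = x' i"
  shows "standard_seed \<iota> l' c' x' S"
  using assms unfolding standard_seed_def by simp

lemma Sigma_seed_Suc: "m \<ge> 1 \<Longrightarrow> Sigma_seed \<iota> (m + 1) = next_seed \<iota> (Sigma_seed \<iota> m)"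
proof -
  assume "m \<ge> 1"
  then have "nat (m + 1 - 1) = Suc (nat (m - 1))" by simp
  with \<open>m \<ge> 1\<close> show ?thesis by (simp add: Sigma_seed_def del: nat_eq_iff)
qed

lemma Sigma_seed_pred: "m \<le> 1 \<Longrightarrow> Sigma_seed \<iota> (m - 1) = prev_seed \<iota> (Sigma_seed \<iota> m)"
proof -
  assume "m \<le> 1"
  then have "nat (1 - (m - 1)) = Suc (nat (1 - m))" by simp
  with \<open>m \<le> 1\<close> show ?thesis by (cases "m = 1") (simp_all add: Sigma_seed_def)
qed

context torus_fractions
begin

text \<open>Induction in both directions from the initial seed. Upwards the first frozen column
  stays nonnegative and nothing is rescaled. Downwards \<open>m = 1, 0, - 1\<close> are treated
  separately from \<open>m \<le> - 2\<close>, as in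
  \<open>cluster_elem_exchange_down\<close>.\<close>

lemma Sigma_seed_standard:
  "standard_seed \<iota> (\<lambda>i. cluster_degree (m + int i - 1)) (column m) (\<lambda>i. \<iota> (cluster_elem (m + int i - 1))) (Sigma_seed \<iota> m)"
proof (induction m rule: int_induct [where k = 1])
  case base
  show ?case
    by (simp add: standard_seed_def Sigma_seed_def initial_seed_def lambda0_def B0_def cluster_degree_def column_def rho_def
      cluster_elem_pos gauged_X_1 gauged_X_2 gauged_X_3 unit6_def vec6_def)
next
  case (step1 m)
  have c: "\<forall>t\<in>{4, 5, 6}. column m 1 t \<ge> 0"
    using step1(1) by (cases "even m"; auto elim!: evenE oddE simp: column_def rho_def)
  have e: "m + int 1 - 1 = m" "m + int 2 - 1 = m + 1" "m + int 3 - 1 = m + 2" "column m 1 t = rho m t" for t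
    using step1(1) by (simp_all add: column_def)
  note standard_next [OF step1(2) c, of "cluster_elem (m + 3)", unfolded e, OF cluster_elem_nonzero cluster_elem_exchange_up [OF step1(1)]]
  then show ?case
    unfolding Sigma_seed_Suc [OF step1(1)]
  proof (rule standard_seed_cong)
    fix i t :: nat assume it: "i \<in> {1, 2, 3}" "t \<in> {4, 5, 6}"
    then show "(if i = 3 then cluster_degree (m + 1) t + cluster_degree (m + 2) t - cluster_degree m t else cluster_degree (m + int (i + 1) - 1) t) =
        cluster_degree (m + 1 + int i - 1) t"
      using step1(1) by (cases "even m"; auto elim!: evenE oddE simp: cluster_degree_def)
    show "(if i = 3 then - rho m t else column m (i + 1) t + rho m t) = column (m + 1) i t"
      using it step1(1) by (cases "even m"; auto elim!: evenE oddE simp: column_def rho_def odd_pred)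
  qed (use step1(1) in \<open>auto simp: add.commute\<close>)
next
  case (step2 m)
  have e: "m + int 1 - 1 = m" "m + int 2 - 1 = m + 1" "m + int 3 - 1 = m + 2"
    by simp_all
  consider "m = 1" | "m = 0" | "m = - 1" | "m \<le> - 2" using step2(1) by linarith
  note m_cases = this
  have neg: "max (- column m 3 t) 0 = - rho (m + 2) t" if "m \<le> - 2" for t
    using that by (cases "even m"; auto elim!: evenE oddE simp: column_def rho_def)
  show ?case
    unfolding Sigma_seed_pred [OF step2(1)]
  proof (rule standard_seed_cong [OF standard_prev [OF step2(2), of "cluster_elem (m - 1)"], unfolded e])
    fix i t :: nat assume it: "i \<in> {1, 2, 3}" "t \<in> {4, 5, 6}"
    show "(if i = 1 then (\<Sum>s\<in>{4, 5, 6}. max (- column m 3 s) 0 * lambda0 s t) - cluster_degree (m + 2) t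
        else cluster_degree (m + int (i - 1) - 1) t) = cluster_degree (m - 1 + int i - 1) t"
      using it by (cases rule: m_cases; cases "even m"; (simp add: neg)?;
        auto simp: column_def rho_def cluster_degree_def lambda0_def odd_pred elim!: evenE oddE)
    show "(if i = 1 then - column m 3 t else column m (i - 1) t - max (- column m 3 t) 0) = column (m - 1) i t"
      using it by (cases rule: m_cases; cases "even m"; (simp add: neg)?;
        auto simp: column_def rho_def odd_pred elim!: evenE oddE)
  next
    show "cluster_elem (m + 2) \<noteq> 0" by (rule cluster_elem_nonzero)
  next
    show "qcomm (2 * (cluster_degree (m + int i - 1) 4 * a + cluster_degree (m + int i - 1) 5 * b + cluster_degree (m + int i - 1) 6 * c))
        (cluster_elem (m + int i - 1)) (yX a b c)" for i a b c
      by (rule qcomm_cluster_elem)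
  next
    show "cluster_elem (m - 1) * cluster_elem (m + 2) =
     qh (\<Sum>t\<in>{4, 5, 6}. (cluster_degree m t + cluster_degree (m + 1) t - cluster_degree (m + 2) t) * max (column m 3 t) 0) *
       (yX (max (column m 3 4) 0) (max (column m 3 5) 0) (max (column m 3 6) 0) * (cluster_elem m * cluster_elem (m + 1))) +
     qh (- (\<Sum>t\<in>{4, 5, 6}. cluster_degree (m + 2) t * max (- column m 3 t) 0)) *
       yX (max (- column m 3 4) 0) (max (- column m 3 5) 0) (max (- column m 3 6) 0)"
      by (rule cluster_elem_exchange_down [OF step2(1)])
  next
    show "(\<Sum>t\<in>{4, 5, 6}. max (- column m 3 t) 0 * cluster_degree m t) = 0"
      by (cases rule: m_cases; cases "even m"; (simp add: neg)?;
        auto simp: column_def rho_def cluster_degree_def lambda0_def odd_pred algebra_simps elim!: evenE oddE)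
    show "(\<Sum>t\<in>{4, 5, 6}. max (- column m 3 t) 0 * cluster_degree (m + 1) t) = 0"
      by (cases rule: m_cases; cases "even m"; (simp add: neg)?;
        auto simp: column_def rho_def cluster_degree_def lambda0_def odd_pred algebra_simps elim!: evenE oddE)
  next
    show "\<iota> (if i = 1 then cluster_elem (m - 1) else cluster_elem (m + int (i - 1) - 1)) = \<iota> (cluster_elem (m - 1 + int i - 1))"
      if "i \<in> {1, 2, 3}" for i
      using that by (auto simp: add.commute)
  qed
qed

lemma cluster_X_eq: "cluster_X \<iota> m = \<iota> (cluster_elem m)"
  using Sigma_seed_standard [of m] by (simp add: cluster_X_def standard_seed_def)

end

section \<open>Membership in the quantum cluster algebra\<close>

context torus_fractions
begin

abbreviation cluster_alg :: "'f set" where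
  "cluster_alg \<equiv> quantum_cluster_algebra \<iota>"

lemma cluster_alg_zero: "0 \<in> cluster_alg"
  using quantum_cluster_algebra.diff [OF quantum_cluster_algebra.one quantum_cluster_algebra.one, of \<iota>] by simp

lemma cluster_alg_add: "a \<in> cluster_alg \<Longrightarrow> b \<in> cluster_alg \<Longrightarrow> a + b \<in> cluster_alg"
  using quantum_cluster_algebra.diff [of a \<iota> "0 - b"]
    quantum_cluster_algebra.diff [OF cluster_alg_zero, of b] by simp

lemma cluster_alg_power: "a \<in> cluster_alg \<Longrightarrow> a ^ n \<in> cluster_alg"
  by (induction n) (auto intro: quantum_cluster_algebra.one quantum_cluster_algebra.mult)

lemma cluster_alg_powi:
  "a \<in> cluster_alg \<Longrightarrow> inverse a \<in> cluster_alg \<Longrightarrow> a powi k \<in> cluster_alg"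
  by (simp add: power_int_def cluster_alg_power)

lemma cluster_alg_image:
  "\<iota> a \<in> cluster_alg \<Longrightarrow> \<iota> b \<in> cluster_alg \<Longrightarrow> \<iota> (a * b) \<in> cluster_alg"
  "\<iota> a \<in> cluster_alg \<Longrightarrow> \<iota> b \<in> cluster_alg \<Longrightarrow> \<iota> (a - b) \<in> cluster_alg"
  "\<iota> a \<in> cluster_alg \<Longrightarrow> \<iota> b \<in> cluster_alg \<Longrightarrow> \<iota> (a + b) \<in> cluster_alg"
  by (simp_all add: mult diff add quantum_cluster_algebra.mult quantum_cluster_algebra.diff cluster_alg_add)

lemma qh_in_alg: "\<iota> (qh k) \<in> cluster_alg"
proof -
  have h: "torus_q (1 / 2) = qh 1" "torus_q (- (1 / 2)) = qh (- 1)"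
    by (rule torus_q_half_int; simp)+
  have q: "\<iota> (qh 1) \<in> cluster_alg" "\<iota> (qh (- 1)) \<in> cluster_alg"
    using quantum_cluster_algebra.q_half [of \<iota>] quantum_cluster_algebra.q_half_inv [of \<iota>] by (simp_all add: h)
  have "\<iota> (qh (int n)) \<in> cluster_alg \<and> \<iota> (qh (- int n)) \<in> cluster_alg" for n
  proof (induction n)
    case (Suc n)
    have "qh (int (Suc n)) = qh 1 * qh (int n)" "qh (- int (Suc n)) = qh (- 1) * qh (- int n)"
      by (simp_all add: qh_mult)
    then show ?case using Suc q by (simp only: cluster_alg_image)
  qed (simp add: quantum_cluster_algebra.one)
  then show ?thesis by (cases k rule: int_cases2) auto
qed

lemma yX_in_alg: "\<iota> (yX a b c) \<in> cluster_alg"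
proof -
  have "\<iota> (yX a 0 0) \<in> cluster_alg" "\<iota> (yX 0 b 0) \<in> cluster_alg" "\<iota> (yX 0 0 c) \<in> cluster_alg"
    unfolding y_powi [symmetric]
    by (intro cluster_alg_powi quantum_cluster_algebra.frozen quantum_cluster_algebra.frozen_inv; simp)+
  then have "\<iota> (qh (a * b + a * c + b * c) * (yX a 0 0 * (yX 0 b 0 * yX 0 0 c))) \<in> cluster_alg"
    by (intro cluster_alg_image qh_in_alg)
  also have "qh (a * b + a * c + b * c) * (yX a 0 0 * (yX 0 b 0 * yX 0 0 c)) = yX a b c"
    by (simp add: yX_mult qh_left_commute [of "yX _ _ _"] qh_mult_left)
  finally show ?thesis .
qed

lemma initial_standard:
  "standard_seed \<iota> (\<lambda>i. cluster_degree (1 + int i - 1)) (column 1) (\<lambda>i. \<iota> (cluster_elem (1 + int i - 1))) (initial_seed \<iota>)"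
  using Sigma_seed_standard [of 1] by (simp add: Sigma_seed_def)

text \<open>\<open>w_elem\<close> is itself a cluster variable: it arises from the initial seed by
  mutation in direction 2.\<close>

lemma w_in_alg: "\<iota> w_elem \<in> cluster_alg"
proof -
  have inv: "inverse (\<iota> (gauged_X 2)) = \<iota> (torus_X (0, - 1, 0, 0, 0, 0))"
    by (rule inverse_unique) (simp add: mult [symmetric] gauged_X_2 torus_X_times)
  have "seed_X (mutate \<iota> 2 (initial_seed \<iota>)) 2 = \<iota> w_elem"
    by (simp add: mutate_def Let_def seed_monomial_standard [OF initial_standard])
      (simp add: initial_seed_def B0_def cluster_elem_pos cluster_degree_def inv,
        simp add: mult [symmetric] add [symmetric] gauged_X_1 gauged_X_3 w_elem_def yX_def torus_norm)
  then show ?thesis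
    using quantum_cluster_algebra.cluster_variable [OF mutation_class.step [OF mutation_class.initial, of 2], of 2 \<iota>]
    by simp
qed

text \<open>\<open>X_1\<close>, \<open>X_2\<close>, \<open>X_3\<close> form the initial cluster, and
  \<open>X_0\<close>, \<open>X_4\<close> arise from it by a single mutation.\<close>

lemma cluster_elem_initial_in_alg: "i \<in> {0, 1, 2, 3, 4} \<Longrightarrow> \<iota> (cluster_elem i) \<in> cluster_alg"
proof -
  have init: "\<iota> (cluster_elem (int i)) \<in> cluster_alg" if "i \<in> {1, 2, 3}" for i
    using quantum_cluster_algebra.cluster_variable [OF mutation_class.initial that, of \<iota>]
      initial_standard that by (simp add: standard_seed_def) auto
  have "seed_X (Sigma_seed \<iota> 0) 1 = seed_X (mutate \<iota> 3 (initial_seed \<iota>)) 3"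
    using Sigma_seed_pred [of 1 \<iota>] by (simp add: prev_seed_def reorder_def Sigma_seed_def)
  then have 0: "\<iota> (cluster_elem 0) \<in> cluster_alg"
    using quantum_cluster_algebra.cluster_variable [OF mutation_class.step [OF mutation_class.initial, of 3], of 3 \<iota>]
      cluster_X_eq [of 0] by (simp add: cluster_X_def)
  have "seed_X (Sigma_seed \<iota> 2) 3 = seed_X (mutate \<iota> 1 (initial_seed \<iota>)) 1"
    using Sigma_seed_Suc [of 1 \<iota>] by (simp add: next_seed_def reorder_def Sigma_seed_def)
  moreover have "seed_X (Sigma_seed \<iota> 2) 3 = \<iota> (cluster_elem 4)"
    using Sigma_seed_standard [of 2] by (simp add: standard_seed_def)
  ultimately have 4: "\<iota> (cluster_elem 4) \<in> cluster_alg"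
    using quantum_cluster_algebra.cluster_variable [OF mutation_class.step [OF mutation_class.initial, of 1], of 1 \<iota>]
    by simp
  show "i \<in> {0, 1, 2, 3, 4} \<Longrightarrow> \<iota> (cluster_elem i) \<in> cluster_alg"
    using 0 4 init [of 1] init [of 2] init [of 3] by auto
qed

text \<open>The product formula for \<open>x_0 x_4\<close> has the correction term
  \<open>h^(-1) R_0 z\<close>, whose coefficient is a unit of the algebra; solve for z.\<close>

lemma z_in_alg: "\<iota> z_elem \<in> cluster_alg"
proof -
  have "g_sum 2 = 1"
    by (simp add: numeral_2_eq_2 q_sum_def)
  then have "gauged_X 0 * gauged_X 4 = gauged_X 2 * gauged_X 2 + qh (- 1) * (R_mon 0 * z_elem)"
    using product_formulas(1) [of 0 2] by (simp add: W_elem_def)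
  then have "z_elem = qh 1 * (yX 0 0 1 * (gauged_X 0 * gauged_X 4 - gauged_X 2 * gauged_X 2))"
    by (simp add: R_mon_def qh_left_commute [of "yX _ _ _"] qh_mult_left yX_mult_left)
  also have "\<iota> \<dots> \<in> cluster_alg"
    using cluster_elem_initial_in_alg [of 0] cluster_elem_initial_in_alg [of 2] cluster_elem_initial_in_alg [of 4] gauged_X_gauged [of 0]
    by (intro cluster_alg_image qh_in_alg yX_in_alg) (auto simp: cluster_elem_pos R_mon_def intro!: cluster_alg_image qh_in_alg yX_in_alg)
  finally show ?thesis .
qed

text \<open>Reordering is not a step of \<open>mutation_class\<close>, so the argument avoids the
  seeds \<open>Sigma_seed\<close>: the recursion starts from \<open>x_1\<close>, \<open>x_2\<close>,
  and its coefficients \<open>W_i\<close>, \<open>A_i\<close> and the inverses of the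
  \<open>A_i\<close> lie in the algebra.\<close>

lemma gauged_X_in_alg: "\<iota> (gauged_X i) \<in> cluster_alg"
proof (induction i rule: int_two_step_induct [where k = 1])
  case base1
  show ?case using cluster_elem_initial_in_alg [of 1] by (simp add: cluster_elem_pos)
next
  case base2
  show ?case using cluster_elem_initial_in_alg [of 2] by (simp add: cluster_elem_pos)
next
  case (up i)
  then show ?case using gauged_X_step_up [of "i + 1"] w_in_alg z_in_alg
    by (simp add: add.assoc) (auto simp: W_elem_def A_mon_def intro!: cluster_alg_image qh_in_alg yX_in_alg)
next
  case (down i)
  then show ?case using gauged_X_step_down [of "i + 1"] w_in_alg z_in_alg
    by (simp add: add.assoc) (auto simp: W_elem_def A_mon_inv_def intro!: cluster_alg_image qh_in_alg yX_in_alg)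
qed

lemma cluster_elem_in_alg: "\<iota> (cluster_elem i) \<in> cluster_alg"
  unfolding cluster_elem_def by (intro cluster_alg_image qh_in_alg yX_in_alg gauged_X_in_alg)

lemma u_in_alg: "\<iota> (u_elem n) \<in> cluster_alg"
proof -
  have u1: "\<iota> u1_elem \<in> cluster_alg"
  proof -
    have eq: "u1_elem = W_elem 0 * W_elem 1 - qh (-1) * A_mon 1 - qh 1 * A_mon 0"
      using W_elem_W_elem_up [of 0] by simp
    show ?thesis unfolding eq
      using w_in_alg z_in_alg by (auto simp: W_elem_def A_mon_def intro!: cluster_alg_image qh_in_alg yX_in_alg)
  qed
  show ?thesis
  proof (induction n rule: u_elem.induct)
    case 1
    show ?case by (simp add: quantum_cluster_algebra.one)
  next
    case 2
    show ?case using u1 by simp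
  next
    case 3
    have "u_elem (Suc (Suc 0)) = u1_elem * u1_elem - (yC + yC)"
      by (simp add: power2_eq_square mult_2 yX_def)
    then show ?case using u1 by (simp only:) (intro cluster_alg_image yX_in_alg)
  next
    case (4 n)
    then show ?case using u1 by (simp add: yX_def [symmetric]) (intro cluster_alg_image yX_in_alg)
  qed
qed

end

section \<open>Leading terms\<close>

text \<open>The monomial by which \<open>X\<^sub>a X\<^sub>b\<close> has to be multiplied to undo the rescaling of \<open>X\<^sub>a\<close>, \<open>X\<^sub>b\<close> and to
  apply that of \<open>X\<^sub>i\<close>.\<close>

definition lead_coeff :: "int \<Rightarrow> int \<Rightarrow> int \<Rightarrow> quantum_torus" where
  "lead_coeff i a b =
    (let p = (\<lambda>t. gauge a t + gauge b t - rho i t)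
     in qh (1 - ((if a \<ge> 1 then 0 else 1) + (if b \<ge> 1 then 0 else 1)
      - 2 * y_degree a (gauge b 4) (gauge b 5) (gauge b 6)
      + gauge a 5 * gauge b 4 - gauge a 4 * gauge b 5 + gauge a 6 * gauge b 4 - gauge a 4 * gauge b 6
      + gauge a 6 * gauge b 5 - gauge a 5 * gauge b 6)
      + (p 5 * (gauge a 4 + gauge b 4) - p 4 * (gauge a 5 + gauge b 5) + p 6 * (gauge a 4 + gauge b 4)
      - p 4 * (gauge a 6 + gauge b 6) + p 6 * (gauge a 5 + gauge b 5) - p 5 * (gauge a 6 + gauge b 6))) *
     yX (p 4) (p 5) (p 6))"

lemma lead_coeff_times: "lead_coeff i a b * cluster_elem a * cluster_elem b =
    qh 1 * (yX (- rho i 4) (- rho i 5) (- rho i 6) * (gauged_X a * gauged_X b))"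
proof -
  have "gauge a t + gauge b t - rho i t + (- gauge a t - gauge b t) = - rho i t" for t
    by simp
  then show ?thesis
    unfolding mult.assoc cluster_elem_mult lead_coeff_def Let_def
    by (simp add: qh_left_commute [of "yX _ _ _"] qh_mult_left yX_mult_left del: qh_mult_cancel)
      (intro arg_cong2 [where f = "(*)"] arg_cong [where f = qh] refl, simp add: algebra_simps)
qed

lemma qh_yX_cong:
  "k = k' \<Longrightarrow> a = a' \<Longrightarrow> b = b' \<Longrightarrow> c = c' \<Longrightarrow> qh k * yX a b c = qh k' * yX a' b' c'"
  by simp

section \<open>Translation into the sums and prefactors of the theorem\<close>

context torus_fractions
begin

text \<open>The left factor is rescaled and the right one is not. The rescaling by
  \<open>h X^(-rho_i)\<close> cancels the coefficient \<open>h^(-1) R_i\<close> of the correction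
  term, which becomes a bare sum.\<close>

lemma product_even:
  assumes "i \<le> 0" "i + 2 * int n \<ge> 1"
  shows "cluster_elem i * cluster_elem (i + 2 * int n) =
    qh 1 * (yX (- rho i 4) (- rho i 5) (- rho i 6) *
      (gauged_X (i + 2 * int (n div 2)) * gauged_X (i + 2 * int ((n + 1) div 2)))) + W_elem (i + 1) * g_sum n"
  unfolding cluster_elem_nonpos [OF assms(1)] cluster_elem_pos [OF assms(2)] mult.assoc product_formulas
  by (simp add: distrib_left R_mon_rho qh_left_commute [of "yX _ _ _"] qh_mult_left)

lemma product_odd:
  assumes "i \<le> 0" "i + 2 * int n + 1 \<ge> 1"
  shows "cluster_elem i * cluster_elem (i + 2 * int n + 1) =
    qh 1 * (yX (- rho i 4) (- rho i 5) (- rho i 6) * (gauged_X (i + int n) * gauged_X (i + int n + 1))) +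
    (g_sum (Suc n) + qh 1 * (A_mon (i + 1) * g_sum n))"
  unfolding cluster_elem_nonpos [OF assms(1)] cluster_elem_pos [OF assms(2)] mult.assoc product_formulas
  by (simp add: distrib_left R_mon_rho qh_left_commute [of "yX _ _ _"] qh_mult_left)

lemma Y_product:
  "\<iota> (torus_X (unit6 4)) * \<iota> (torus_X (unit6 5)) * \<iota> (torus_X (unit6 6)) = \<iota> (qh (- 3) * yC)"
  using y_powi(1) [of 1] y_powi(2) [of 1] y_powi(3) [of 1]
  by (simp add: mult [symmetric] yX_mult mult.assoc qh_left_commute [of "yX _ _ _"] qh_mult_left)

lemma yC_power: "yC ^ n = yX (int n) (int n) (int n)"
  by (induction n) (simp_all add: yX_mult)

lemma Y_powi: "\<iota> (qh (- 3) * yC) powi k = \<iota> (qh (- 3 * k) * yX k k k)"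
proof -
  have p: "\<iota> (qh (- 3) * yC) ^ n = \<iota> (qh (- 3 * int n) * yX (int n) (int n) (int n))" for n
    by (induction n) (simp_all add: mult [symmetric] yX_mult mult.assoc qh_left_commute [of "yX _ _ _"] qh_mult_left
      algebra_simps)
  have "inverse (\<iota> (qh (- 3 * int n) * yX (int n) (int n) (int n))) =
      \<iota> (qh (3 * int n) * yX (- int n) (- int n) (- int n))" for n
    by (rule inverse_unique) (simp add: mult [symmetric] yX_mult mult.assoc qh_mult qh_left_commute [of "yX _ _ _"] qh_mult_left)
  with p show ?thesis
    by (cases k rule: int_cases2) (simp_all add: power_int_def power_inverse)
qed

text \<open>As \<open>y_1 y_2 y_3 = h^(-3) C\<close>, the powers \<open>q^(3l/2)\<close> turn
  \<open>(y_1 y_2 y_3)^l\<close> into \<open>C^l\<close>. For \<open>n = -2\<close> and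
  \<open>n = -1\<close> the range of \<open>l\<close> is empty and \<open>g_sum\<close>
  vanishes.\<close>

lemma g_sum_expansion:
  assumes "n \<ge> - 2"
  shows "(\<Sum>l = 0..n div 2. (\<Sum>i = 0..l. \<iota> (torus_q (of_int (2 * i + 3 * l) / 2))) *
      \<iota> (u_elem (nat (n - 2 * l))) * \<iota> (qh (- 3) * yC) powi l) = \<iota> (g_sum (nat (n + 2)))"
proof (cases "n \<ge> 0")
  case False
  then have "n div 2 < 0" "nat (n + 2) = 0 \<or> nat (n + 2) = Suc 0" by auto
  then show ?thesis by auto
next
  case True
  then obtain k where n: "n = int k" using nonneg_int_cases by blast
  have "(\<Sum>l = 0..n div 2. (\<Sum>i = 0..l. \<iota> (torus_q (of_int (2 * i + 3 * l) / 2))) *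
      \<iota> (u_elem (nat (n - 2 * l))) * \<iota> (qh (- 3) * yC) powi l) =
    (\<Sum>l\<le>k div 2. \<iota> (q_sum l * u_elem (k - 2 * l) * yC ^ l))"
  proof (rule sum.reindex_bij_witness [of _ int nat])
    fix l :: int assume l: "l \<in> {0..n div 2}"
    then obtain j where j: "l = int j" using nonneg_int_cases by auto
    have "(\<Sum>i = 0..l. \<iota> (torus_q (of_int (2 * i + 3 * l) / 2))) = (\<Sum>i\<le>j. \<iota> (qh (2 * int i + 3 * int j)))"
      unfolding j by (rule sum.reindex_bij_witness [of _ int nat]) (auto simp: qh_def)
    also have "\<dots> = \<iota> (qh (3 * int j) * q_sum j)"
      by (simp add: sum q_sum_def sum_distrib_left qh_mult add.commute)
    finally have "(\<Sum>i = 0..l. \<iota> (torus_q (of_int (2 * i + 3 * l) / 2))) = \<iota> (qh (3 * int j) * q_sum j)" .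
    note s = this
    have "nat (n - 2 * l) = k - 2 * j" using n j by auto
    then show "\<iota> (q_sum (nat l) * u_elem (k - 2 * nat l) * yC ^ nat l) =
      (\<Sum>i = 0..l. \<iota> (torus_q (of_int (2 * i + 3 * l) / 2))) *
      \<iota> (u_elem (nat (n - 2 * l))) * \<iota> (qh (- 3) * yC) powi l"
      unfolding s Y_powi by (simp add: j mult [symmetric] yC_power mult.assoc qh_left_commute [of "u_elem _"]
        qh_left_commute [of "q_sum _"] qh_mult_left)
  qed (auto simp: n)
  also have "\<dots> = \<iota> (g_sum (nat (n + 2)))"
    by (simp add: n nat_add_distrib sum)
  finally show ?thesis .
qed

text \<open>Normal forms of the prefactors P: one power of q times one frozen monomial. Merging with
  \<open>C^k\<close> costs \<open>h^(-2k)\<close> for \<open>y_1\<close> and gains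
  \<open>h^(2k)\<close> for \<open>y_3\<close>, while \<open>y_2\<close> commutes with
  \<open>C\<close>.\<close>

lemma lead_monomials:
  fixes k :: int
  defines "Y \<equiv> \<iota> (qh (- 3) * yC) powi k"
  shows "\<iota> (qh s) * Y = \<iota> (qh (s - 3 * k) * yX k k k)"
    "\<iota> (qh s) * \<iota> (yX 1 0 0) * Y = \<iota> (qh (s - 5 * k) * yX (k + 1) k k)"
    "\<iota> (qh s) * \<iota> (yX 0 1 0) * Y = \<iota> (qh (s - 3 * k) * yX k (k + 1) k)"
    "\<iota> (qh s) * \<iota> (yX 0 0 1) * Y = \<iota> (qh (s - k) * yX k k (k + 1))"
    "\<iota> (qh s) * \<iota> (yX 1 0 0) * \<iota> (yX 0 1 0) * Y = \<iota> (qh (s - 1 - 5 * k) * yX (k + 1) (k + 1) k)"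
    "\<iota> (qh s) * \<iota> (yX 0 1 0) * \<iota> (yX 0 0 1) * Y = \<iota> (qh (s - 1 - k) * yX k (k + 1) (k + 1))"
  unfolding Y_def Y_powi
  by (simp_all add: mult [symmetric] mult.assoc qh_left_commute [of "yX _ _ _"] qh_mult_left yX_mult add.commute)

end

section \<open>The twelve leading coefficients\<close>

lemma lead_coeff_pos: "1 \<le> a \<Longrightarrow> 1 \<le> b \<Longrightarrow>
    lead_coeff i a b = qh 1 * yX (- rho i 4) (- rho i 5) (- rho i 6)"
  by (simp add: lead_coeff_def gauge_def y_degree_def)

lemma lead_coeff_nonpos: "a \<le> 0 \<Longrightarrow> b \<le> 0 \<Longrightarrow>
  lead_coeff i a b = qh (- 1
      + 2 * y_degree a (rho b 4) (rho b 5) (rho b 6)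
      - rho a 5 * rho b 4 + rho a 4 * rho b 5 - rho a 6 * rho b 4 + rho a 4 * rho b 6
      - rho a 6 * rho b 5 + rho a 5 * rho b 6
      - (rho i 5 * (rho a 4 + rho b 4) - rho i 4 * (rho a 5 + rho b 5) + rho i 6 * (rho a 4 + rho b 4)
      - rho i 4 * (rho a 6 + rho b 6) + rho i 6 * (rho a 5 + rho b 5) - rho i 5 * (rho a 6 + rho b 6))) *
     yX (rho a 4 + rho b 4 - rho i 4) (rho a 5 + rho b 5 - rho i 5) (rho a 6 + rho b 6 - rho i 6)"
  unfolding lead_coeff_def Let_def by (rule qh_yX_cong) (simp_all add: gauge_def algebra_simps)

lemma rho_parity:
  "rho (2 * k) 4 = k" "rho (2 * k) 5 = k" "rho (2 * k) 6 = k - 1"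
  "rho (2 * k + 1) 4 = k + 1" "rho (2 * k + 1) 5 = k" "rho (2 * k + 1) 6 = k"
  by (simp_all add: rho_def)

lemma y_degree_by_parity: "y_degree (2 * k) a b c = (k - 1) * a - b + (1 - k) * c"
  "y_degree (2 * k + 1) a b c = (k - 1) * a - k * c"
  by (simp_all add: y_degree_def)

text \<open>The names of the following lemmas give the parity of \<open>m\<close>, the identity and
  the case. In case 1 both factors on the right have nonpositive index, in case 2 only the first, in
  case 3 neither. The left sides keep the shape produced by \<open>lead_monomials\<close>. Case 1
  splits by the parity of \<open>n\<close> because \<open>rho\<close> and \<open>y_degree\<close>
  are evaluated by the parity of the index.\<close>

lemma lead_odd_i1:
  fixes k n :: int
  assumes "k \<le> n" "n \<le> 2 * k - 1"
  shows "qh (7 * n - 5 * k + 2 - 1 - 5 * (n - k)) * yX (n - k + 1) (n - k + 1) (n - k) = lead_coeff (- (2 * k + 1)) (n - 2 * k) (n - 2 * k + 1)"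
proof (cases "even n")
  case True
  then obtain j where n: "n = 2 * j" by (elim evenE)
  have e: "lead_coeff (- (2 * k + 1)) (n - 2 * k) (n - 2 * k + 1) =
      lead_coeff (2 * (- k - 1) + 1) (2 * (j - k)) (2 * (j - k) + 1)"
    by (rule arg_cong3 [where f = lead_coeff]) (use n in auto)
  have neg: "2 * (j - k) \<le> 0" "2 * (j - k) + 1 \<le> 0"
    using assms n by presburger+
  show ?thesis
    unfolding e unfolding lead_coeff_nonpos [OF neg] rho_parity y_degree_by_parity
    by (rule qh_yX_cong) (simp_all add: n algebra_simps)
next
  case False
  then obtain j where n: "n = 2 * j + 1" by (elim oddE)
  have e: "lead_coeff (- (2 * k + 1)) (n - 2 * k) (n - 2 * k + 1) =
      lead_coeff (2 * (- k - 1) + 1) (2 * (j - k) + 1) (2 * (j - k + 1))"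
    by (rule arg_cong3 [where f = lead_coeff]) (use n in auto)
  have neg: "2 * (j - k) + 1 \<le> 0" "2 * (j - k + 1) \<le> 0"
    using assms n by presburger+
  show ?thesis
    unfolding e unfolding lead_coeff_nonpos [OF neg] rho_parity y_degree_by_parity
    by (rule qh_yX_cong) (simp_all add: n algebra_simps)
qed

lemma lead_odd_i2:
  fixes k n :: int
  assumes "0 \<le> k" "n = 2 * k"
  shows "qh (5 * k + 1 - 3 * (k)) * yX (k) (k + 1) (k) = lead_coeff (- (2 * k + 1)) (n - 2 * k) (n - 2 * k + 1)"
proof -
  have e: "lead_coeff (- (2 * k + 1)) (n - 2 * k) (n - 2 * k + 1) = lead_coeff (2 * (- k - 1) + 1) (0) (1)"
    by (rule arg_cong3 [where f = lead_coeff]) (use assms in auto)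
  show ?thesis
    unfolding e unfolding lead_coeff_def Let_def rho_parity
    by (rule qh_yX_cong) (simp_all add: gauge_def rho_def y_degree_def)
qed

lemma lead_odd_i3:
  fixes k n :: int
  assumes "0 \<le> k" "2 * k + 1 \<le> n"
  shows "qh (k + 2 - 1 - (k)) * yX (k) (k + 1) (k + 1) = lead_coeff (- (2 * k + 1)) (n - 2 * k) (n - 2 * k + 1)"
proof -
  have e: "lead_coeff (- (2 * k + 1)) (n - 2 * k) (n - 2 * k + 1) =
      lead_coeff (2 * (- k - 1) + 1) (n - 2 * k) (n - 2 * k + 1)"
    by (rule arg_cong3 [where f = lead_coeff]) auto
  have pos: "1 \<le> n - 2 * k" "1 \<le> n - 2 * k + 1" using assms by presburger+
  show ?thesis
    unfolding e unfolding lead_coeff_pos [OF pos] rho_parity by (rule qh_yX_cong) simp_all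
qed

lemma lead_odd_ii1:
  fixes k n :: int
  assumes "k + 1 \<le> n" "n \<le> 2 * k"
  shows "qh (7 * n - 5 * k - 8 - 5 * (n - k - 1)) * yX (n - k - 1 + 1) (n - k - 1) (n - k - 1) = lead_coeff (- (2 * k + 1)) (- (2 * k + 1) + 2 * (n div 2)) (- (2 * k + 1) + 2 * ((n + 1) div 2))"
proof (cases "even n")
  case True
  then obtain j where n: "n = 2 * j" by (elim evenE)
  have e: "lead_coeff (- (2 * k + 1)) (- (2 * k + 1) + 2 * (n div 2)) (- (2 * k + 1) + 2 * ((n + 1) div 2)) =
      lead_coeff (2 * (- k - 1) + 1) (2 * (j - k - 1) + 1) (2 * (j - k - 1) + 1)"
    by (rule arg_cong3 [where f = lead_coeff]) (use n in auto)
  have neg: "2 * (j - k - 1) + 1 \<le> 0" "2 * (j - k - 1) + 1 \<le> 0"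
    using assms n by presburger+
  show ?thesis
    unfolding e unfolding lead_coeff_nonpos [OF neg] rho_parity y_degree_by_parity
    by (rule qh_yX_cong) (simp_all add: n algebra_simps)
next
  case False
  then obtain j where n: "n = 2 * j + 1" by (elim oddE)
  have e: "lead_coeff (- (2 * k + 1)) (- (2 * k + 1) + 2 * (n div 2)) (- (2 * k + 1) + 2 * ((n + 1) div 2)) =
      lead_coeff (2 * (- k - 1) + 1) (2 * (j - k - 1) + 1) (2 * (j - k) + 1)"
    by (rule arg_cong3 [where f = lead_coeff]) (use n in auto)
  have neg: "2 * (j - k - 1) + 1 \<le> 0" "2 * (j - k) + 1 \<le> 0"
    using assms n by presburger+
  show ?thesis
    unfolding e unfolding lead_coeff_nonpos [OF neg] rho_parity y_degree_by_parity
    by (rule qh_yX_cong) (simp_all add: n algebra_simps)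
qed

lemma lead_odd_ii2:
  fixes k n :: int
  assumes "0 \<le> k" "n = 2 * k + 1"
  shows "qh (5 * k - 3 * (k)) * yX (k) (k) (k) = lead_coeff (- (2 * k + 1)) (- (2 * k + 1) + 2 * (n div 2)) (- (2 * k + 1) + 2 * ((n + 1) div 2))"
proof -
  have e: "lead_coeff (- (2 * k + 1)) (- (2 * k + 1) + 2 * (n div 2)) (- (2 * k + 1) + 2 * ((n + 1) div 2)) = lead_coeff (2 * (- k - 1) + 1) (- 1) (1)"
    by (rule arg_cong3 [where f = lead_coeff]) (use assms in auto)
  show ?thesis
    unfolding e unfolding lead_coeff_def Let_def rho_parity
    by (rule qh_yX_cong) (simp_all add: gauge_def rho_def y_degree_def)
qed

lemma lead_odd_ii3:
  fixes k n :: int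
  assumes "0 \<le> k" "2 * k + 2 \<le> n"
  shows "qh (k + 2 - 1 - (k)) * yX (k) (k + 1) (k + 1) = lead_coeff (- (2 * k + 1)) (- (2 * k + 1) + 2 * (n div 2)) (- (2 * k + 1) + 2 * ((n + 1) div 2))"
proof -
  have e: "lead_coeff (- (2 * k + 1)) (- (2 * k + 1) + 2 * (n div 2)) (- (2 * k + 1) + 2 * ((n + 1) div 2)) =
      lead_coeff (2 * (- k - 1) + 1) (- (2 * k + 1) + 2 * (n div 2)) (- (2 * k + 1) + 2 * ((n + 1) div 2))"
    by (rule arg_cong3 [where f = lead_coeff]) auto
  have pos: "1 \<le> - (2 * k + 1) + 2 * (n div 2)" "1 \<le> - (2 * k + 1) + 2 * ((n + 1) div 2)" using assms by presburger+
  show ?thesis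
    unfolding e unfolding lead_coeff_pos [OF pos] rho_parity by (rule qh_yX_cong) simp_all
qed

lemma lead_even_i1:
  fixes k n :: int
  assumes "k - 1 \<le> n" "n \<le> 2 * k - 2"
  shows "qh (7 * n - 5 * k + 6 - 5 * (n - k + 1)) * yX (n - k + 1 + 1) (n - k + 1) (n - k + 1) = lead_coeff (- (2 * k)) (n - 2 * k + 1) (n - 2 * k + 2)"
proof (cases "even n")
  case True
  then obtain j where n: "n = 2 * j" by (elim evenE)
  have e: "lead_coeff (- (2 * k)) (n - 2 * k + 1) (n - 2 * k + 2) =
      lead_coeff (2 * (- k)) (2 * (j - k) + 1) (2 * (j - k + 1))"
    by (rule arg_cong3 [where f = lead_coeff]) (use n in auto)
  have neg: "2 * (j - k) + 1 \<le> 0" "2 * (j - k + 1) \<le> 0"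
    using assms n by presburger+
  show ?thesis
    unfolding e unfolding lead_coeff_nonpos [OF neg] rho_parity y_degree_by_parity
    by (rule qh_yX_cong) (simp_all add: n algebra_simps)
next
  case False
  then obtain j where n: "n = 2 * j + 1" by (elim oddE)
  have e: "lead_coeff (- (2 * k)) (n - 2 * k + 1) (n - 2 * k + 2) =
      lead_coeff (2 * (- k)) (2 * (j - k + 1)) (2 * (j - k + 1) + 1)"
    by (rule arg_cong3 [where f = lead_coeff]) (use n in auto)
  have neg: "2 * (j - k + 1) \<le> 0" "2 * (j - k + 1) + 1 \<le> 0"
    using assms n by presburger+
  show ?thesis
    unfolding e unfolding lead_coeff_nonpos [OF neg] rho_parity y_degree_by_parity
    by (rule qh_yX_cong) (simp_all add: n algebra_simps)
qed

lemma lead_even_i2: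
  fixes k n :: int
  assumes "1 \<le> k" "n = 2 * k - 1"
  shows "qh (5 * k - 3 * (k)) * yX (k) (k) (k) = lead_coeff (- (2 * k)) (n - 2 * k + 1) (n - 2 * k + 2)"
proof -
  have e: "lead_coeff (- (2 * k)) (n - 2 * k + 1) (n - 2 * k + 2) = lead_coeff (2 * (- k)) (0) (1)"
    by (rule arg_cong3 [where f = lead_coeff]) (use assms in auto)
  show ?thesis
    unfolding e unfolding lead_coeff_def Let_def rho_parity
    by (rule qh_yX_cong) (simp_all add: gauge_def rho_def y_degree_def)
qed

lemma lead_even_i3:
  fixes k n :: int
  assumes "0 \<le> k" "2 * k \<le> n"
  shows "qh (k + 1 - (k)) * yX (k) (k) (k + 1) = lead_coeff (- (2 * k)) (n - 2 * k + 1) (n - 2 * k + 2)"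
proof -
  have e: "lead_coeff (- (2 * k)) (n - 2 * k + 1) (n - 2 * k + 2) =
      lead_coeff (2 * (- k)) (n - 2 * k + 1) (n - 2 * k + 2)"
    by (rule arg_cong3 [where f = lead_coeff]) auto
  have pos: "1 \<le> n - 2 * k + 1" "1 \<le> n - 2 * k + 2" using assms by presburger+
  show ?thesis
    unfolding e unfolding lead_coeff_pos [OF pos] rho_parity by (rule qh_yX_cong) simp_all
qed

lemma lead_even_ii1:
  fixes k n :: int
  assumes "k + 1 \<le> n" "n \<le> 2 * k"
  shows "qh (7 * n - 5 * k - 7 - 1 - 5 * (n - k - 1)) * yX (n - k - 1 + 1) (n - k - 1 + 1) (n - k - 1) = lead_coeff (- (2 * k)) (- (2 * k) + 2 * (n div 2)) (- (2 * k) + 2 * ((n + 1) div 2))"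
proof (cases "even n")
  case True
  then obtain j where n: "n = 2 * j" by (elim evenE)
  have e: "lead_coeff (- (2 * k)) (- (2 * k) + 2 * (n div 2)) (- (2 * k) + 2 * ((n + 1) div 2)) =
      lead_coeff (2 * (- k)) (2 * (j - k)) (2 * (j - k))"
    by (rule arg_cong3 [where f = lead_coeff]) (use n in auto)
  have neg: "2 * (j - k) \<le> 0" "2 * (j - k) \<le> 0"
    using assms n by presburger+
  show ?thesis
    unfolding e unfolding lead_coeff_nonpos [OF neg] rho_parity y_degree_by_parity
    by (rule qh_yX_cong) (simp_all add: n algebra_simps)
next
  case False
  then obtain j where n: "n = 2 * j + 1" by (elim oddE)
  have e: "lead_coeff (- (2 * k)) (- (2 * k) + 2 * (n div 2)) (- (2 * k) + 2 * ((n + 1) div 2)) =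
      lead_coeff (2 * (- k)) (2 * (j - k)) (2 * (j - k + 1))"
    by (rule arg_cong3 [where f = lead_coeff]) (use n in auto)
  have neg: "2 * (j - k) \<le> 0" "2 * (j - k + 1) \<le> 0"
    using assms n by presburger+
  show ?thesis
    unfolding e unfolding lead_coeff_nonpos [OF neg] rho_parity y_degree_by_parity
    by (rule qh_yX_cong) (simp_all add: n algebra_simps)
qed

lemma lead_even_ii2:
  fixes k n :: int
  assumes "0 \<le> k" "n = 2 * k + 1"
  shows "qh (5 * k - 3 * (k)) * yX (k) (k) (k) = lead_coeff (- (2 * k)) (- (2 * k) + 2 * (n div 2)) (- (2 * k) + 2 * ((n + 1) div 2))"
proof -
  have e: "lead_coeff (- (2 * k)) (- (2 * k) + 2 * (n div 2)) (- (2 * k) + 2 * ((n + 1) div 2)) = lead_coeff (2 * (- k)) (0) (2)"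
    by (rule arg_cong3 [where f = lead_coeff]) (use assms in auto)
  show ?thesis
    unfolding e unfolding lead_coeff_def Let_def rho_parity
    by (rule qh_yX_cong) (simp_all add: gauge_def rho_def y_degree_def)
qed

lemma lead_even_ii3:
  fixes k n :: int
  assumes "0 \<le> k" "2 * k + 2 \<le> n"
  shows "qh (k + 1 - (k)) * yX (k) (k) (k + 1) = lead_coeff (- (2 * k)) (- (2 * k) + 2 * (n div 2)) (- (2 * k) + 2 * ((n + 1) div 2))"
proof -
  have e: "lead_coeff (- (2 * k)) (- (2 * k) + 2 * (n div 2)) (- (2 * k) + 2 * ((n + 1) div 2)) =
      lead_coeff (2 * (- k)) (- (2 * k) + 2 * (n div 2)) (- (2 * k) + 2 * ((n + 1) div 2))"
    by (rule arg_cong3 [where f = lead_coeff]) auto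
  have pos: "1 \<le> - (2 * k) + 2 * (n div 2)" "1 \<le> - (2 * k) + 2 * ((n + 1) div 2)" using assms by presburger+
  show ?thesis
    unfolding e unfolding lead_coeff_pos [OF pos] rho_parity by (rule qh_yX_cong) simp_all
qed

lemma floor_half: "\<lfloor>of_int n / 2 :: rat\<rfloor> = n div 2" and ceiling_half: "\<lceil>of_int n / 2 :: rat\<rceil> = (n + 1) div 2"
proof -
  show "\<lfloor>of_int n / 2 :: rat\<rfloor> = n div 2"
    using floor_divide_of_int_eq [of n 2] by simp
  show "\<lceil>of_int n / 2 :: rat\<rceil> = (n + 1) div 2"
  proof -
    have "\<lceil>of_int n / of_int 2 :: rat\<rceil> = - (- n div 2)" by (rule ceiling_divide_eq_div)
    then show ?thesis by simp
  qed
qed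

section \<open>Assembly of the four identities\<close>

context torus_fractions
begin

lemma y_image:
  "\<iota> (torus_X (unit6 4)) = \<iota> (yX 1 0 0)" "\<iota> (torus_X (unit6 5)) = \<iota> (yX 0 1 0)"
  "\<iota> (torus_X (unit6 6)) = \<iota> (yX 0 0 1)"
  using y_powi [of 1] by simp_all

lemma product_odd_int:
  assumes "0 \<le> m" "0 \<le> n" "m \<le> 2 * n + 2"
  shows "\<iota> (cluster_elem (- m)) * \<iota> (cluster_elem (- m + 2 * n + 3)) =
    \<iota> (lead_coeff (- m) (- m + n + 1) (- m + n + 2)) * \<iota> (cluster_elem (- m + n + 1)) * \<iota> (cluster_elem (- m + n + 2)) +
    \<iota> (g_sum (nat (n + 2))) + \<iota> (A_mon (- m + 1)) * (\<iota> (qh 1) * \<iota> (g_sum (nat (n - 1 + 2))))"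
proof -
  \<comment> \<open>The distance \<open>2 * n + 3\<close> in the theorem is \<open>2 * k + 1\<close>
    in \<open>product_formulas\<close>, hence the shift by one.\<close>
  define k where "k = nat (n + 1)"
  have k: "- m + 2 * n + 3 = - m + 2 * int k + 1" "nat (n + 2) = Suc k" "nat (n - 1 + 2) = k"
    "- m + n + 1 = - m + int k" "- m + n + 2 = - m + int k + 1"
    using assms by (auto simp: k_def)
  have "1 \<le> - m + 2 * int k + 1" "- m \<le> 0" using assms by (auto simp: k_def)
  then show ?thesis
    unfolding k mult [symmetric] add [symmetric] eq_iff lead_coeff_times qh_left_commute [of "A_mon _"]
    by (subst product_odd) (simp_all add: add.assoc)
qed

lemma product_even_int:
  assumes "0 \<le> m" "0 \<le> n" "m + 1 \<le> 2 * n"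
  shows "\<iota> (cluster_elem (- m)) * \<iota> (cluster_elem (- m + 2 * n)) =
    \<iota> (lead_coeff (- m) (- m + 2 * (n div 2)) (- m + 2 * ((n + 1) div 2))) *
      \<iota> (cluster_elem (- m + 2 * (n div 2))) * \<iota> (cluster_elem (- m + 2 * ((n + 1) div 2))) +
    \<iota> (W_elem (- m + 1)) * \<iota> (g_sum (nat (n - 2 + 2)))"
proof -
  define k where "k = nat n"
  have k: "n = int k" "nat (n - 2 + 2) = k"
    using assms by (auto simp: k_def)
  have d: "int k div 2 = int (k div 2)" "(int k + 1) div 2 = int ((k + 1) div 2)"
    by (simp_all add: zdiv_int)
  have "1 \<le> - m + 2 * int k" "- m \<le> 0" using assms by (auto simp: k_def)
  then show ?thesis
    unfolding k(2) unfolding k(1) d mult [symmetric] add [symmetric] eq_iff lead_coeff_times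
    by (rule product_even [rotated])
qed

text \<open>The offset \<open>c\<close> in the exponent is a central factor; \<open>c = 1\<close>
  serves odd \<open>m\<close> and \<open>c = 2\<close> even \<open>m\<close>.\<close>

lemma g_sum_expansion_shift:
  assumes "n \<ge> - 2"
  shows "(\<Sum>l = 0..n div 2. (\<Sum>i = 0..l. \<iota> (torus_q (of_int (2 * i + c + 3 * l) / 2))) *
      \<iota> (u_elem (nat (n - 2 * l))) * \<iota> (qh (- 3) * yC) powi l) = \<iota> (qh c) * \<iota> (g_sum (nat (n + 2)))"
proof -
  have q: "torus_q (of_int (2 * i + c + 3 * l) / 2) = qh c * torus_q (of_int (2 * i + 3 * l) / 2)" for i l
    using qh_mult [of c "2 * i + 3 * l"] by (simp add: qh_def add.commute add.left_commute)
  show ?thesis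
    unfolding g_sum_expansion [OF assms, symmetric] q mult sum_distrib_left
    by (simp add: sum_distrib_left mult.assoc sum_distrib_right)
qed

lemma torus_q_of_even_quarter:
  "torus_q (of_int k / 4) = qh j" if "k = 2 * j"
  using that by (intro torus_q_half_int) simp

end

theorem theorem3p12:
  fixes \<iota> :: "quantum_torus \<Rightarrow> 'f :: division_ring"
    and m n :: int
  assumes "is_skew_field_of_fractions \<iota>"
    and "0 \<le> m" and "0 \<le> n"
  shows
    "let A = quantum_cluster_algebra \<iota>;
         X = cluster_X \<iota>;
         q = (\<lambda>r::rat. \<iota> (torus_q r));
         w = \<iota> w_elem;
         z = \<iota> z_elem;
         u = (\<lambda>k::int. \<iota> (u_elem (nat k)));
         y1 = \<iota> (torus_X (unit6 4));
         y2 = \<iota> (torus_X (unit6 5));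
         y3 = \<iota> (torus_X (unit6 6));
         Y = y1 * y2 * y3
     in
       range X \<subseteq> A \<and> w \<in> A \<and> z \<in> A \<and> (\<forall>k\<ge>0. u k \<in> A) \<and>
       (odd m \<longrightarrow>
         (\<forall>P.
           ((m - 1) div 2 \<le> n \<and> n \<le> m - 2 \<and>
              P = q (of_int (14 * n - 5 * m + 9) / 4) * y1 * y2 * Y powi ((2 * n - m + 1) div 2)
            \<or> n = m - 1 \<and>
              P = q (of_int (5 * m - 3) / 4) * y2 * Y powi ((m - 1) div 2)
            \<or> n \<ge> m \<and>
              P = q (of_int (m + 3) / 4) * y2 * y3 * Y powi ((m - 1) div 2)) \<longrightarrow>
           X (- m) * X (- m + 2 * n + 3) =
             P * X (- m + n + 1) * X (- m + n + 2)
             + (\<Sum>l = 0..n div 2.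
                 (\<Sum>i = 0..l. q (of_int (2 * i + 3 * l) / 2)) * u (n - 2 * l) * Y powi l)
             + y2 * (\<Sum>l = 0..(n - 1) div 2.
                 (\<Sum>i = 0..l. q (of_int (2 * i + 1 + 3 * l) / 2)) * u (n - 1 - 2 * l) * Y powi l)) \<and>
         (\<forall>P.
           ((m + 1) div 2 \<le> n \<and> n \<le> m - 1 \<and>
              P = q (of_int (14 * n - 5 * m - 11) / 4) * y1 * Y powi ((2 * n - m - 1) div 2)
            \<or> n = m \<and>
              P = q (of_int (5 * m - 5) / 4) * Y powi ((m - 1) div 2)
            \<or> n \<ge> m + 1 \<and>
              P = q (of_int (m + 3) / 4) * y2 * y3 * Y powi ((m - 1) div 2)) \<longrightarrow>
           X (- m) * X (- m + 2 * n) =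
             P * X (- m + 2 * \<lfloor>of_int n / 2 :: rat\<rfloor>) * X (- m + 2 * \<lceil>of_int n / 2 :: rat\<rceil>)
             + w * (\<Sum>l = 0..(n - 2) div 2.
                 (\<Sum>i = 0..l. q (of_int (2 * i + 3 * l) / 2)) * u (n - 2 - 2 * l) * Y powi l))) \<and>
       (even m \<longrightarrow>
         (\<forall>P.
           ((m - 2) div 2 \<le> n \<and> n \<le> m - 2 \<and>
              P = q (of_int (14 * n - 5 * m + 12) / 4) * y1 * Y powi ((2 * n - m + 2) div 2)
            \<or> n = m - 1 \<and>
              P = q (of_int (5 * m) / 4) * Y powi (m div 2)
            \<or> n \<ge> m \<and>
              P = q (of_int (m + 2) / 4) * y3 * Y powi (m div 2)) \<longrightarrow>
           X (- m) * X (- m + 2 * n + 3) =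
             P * X (- m + n + 1) * X (- m + n + 2)
             + (\<Sum>l = 0..n div 2.
                 (\<Sum>i = 0..l. q (of_int (2 * i + 3 * l) / 2)) * u (n - 2 * l) * Y powi l)
             + y1 * y3 * (\<Sum>l = 0..(n - 1) div 2.
                 (\<Sum>i = 0..l. q (of_int (2 * i + 2 + 3 * l) / 2)) * u (n - 1 - 2 * l) * Y powi l)) \<and>
         (\<forall>P.
           ((m + 2) div 2 \<le> n \<and> n \<le> m \<and>
              P = q (of_int (14 * n - 5 * m - 14) / 4) * y1 * y2 * Y powi ((2 * n - m - 2) div 2)
            \<or> n = m + 1 \<and>
              P = q (of_int (5 * m) / 4) * Y powi (m div 2)
            \<or> n \<ge> m + 2 \<and>
              P = q (of_int (m + 2) / 4) * y3 * Y powi (m div 2)) \<longrightarrow>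
           X (- m) * X (- m + 2 * n) =
             P * X (- m + 2 * \<lfloor>of_int n / 2 :: rat\<rfloor>) * X (- m + 2 * \<lceil>of_int n / 2 :: rat\<rceil>)
             + z * (\<Sum>l = 0..(n - 2) div 2.
                 (\<Sum>i = 0..l. q (of_int (2 * i + 3 * l) / 2)) * u (n - 2 - 2 * l) * Y powi l)))"
proof -
  interpret torus_fractions \<iota> by standard fact
  show ?thesis
    unfolding Let_def Y_product
    unfolding y_image cluster_X_eq floor_half ceiling_half
  \<comment> \<open>Goals 1 to 4 are the membership claims, 5 and 6 the identities for odd
    \<open>m\<close>, 7 and 8 those for even \<open>m\<close>.\<close>
  proof (intro conjI impI allI, goal_cases)
    case 1 show ?case using cluster_elem_in_alg by auto
  next
    case 2 show ?case by (rule w_in_alg)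
  next
    case 3 show ?case by (rule z_in_alg)
  next
    case 4 show ?case by (rule u_in_alg)
  next
    case (5 P)
    then obtain k where m: "m = 2 * k + 1" by (elim oddE)
    have k: "0 \<le> k" using \<open>0 \<le> m\<close> m by simp
    have idx: "n - 2 * k = - m + n + 1" "- m + n + 1 + 1 = - m + n + 2" "2 * k + 1 = m"
      by (simp_all add: m)
    have q:
      "torus_q (of_int (14 * n - 5 * m + 9) / 4) = qh (7 * n - 5 * k + 2)"
      "torus_q (of_int (5 * m - 3) / 4) = qh (5 * k + 1)"
      "torus_q (of_int (m + 3) / 4) = qh (k + 2)"
      by (rule torus_q_of_even_quarter; simp add: m)+
    have d: "(2 * n - m + 1) div 2 = n - k" "(m - 1) div 2 = k"
      by (simp_all add: m)
    \<comment> \<open>In each case P is \<open>lead_coeff\<close>, and the bounds on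
      \<open>n\<close> make the index \<open>- m + 2 * n + 3\<close> of the right factor positive,
      as \<open>product_odd_int\<close> requires.\<close>
    have "P = \<iota> (lead_coeff (- m) (- m + n + 1) (- m + n + 2)) \<and> m \<le> 2 * n + 2"
      using 5(2)
    proof (elim disjE conjE, goal_cases)
      case 1
      show ?case
        unfolding 1(3) q d lead_monomials by (subst lead_odd_i1 [of k n, unfolded idx]; (rule conjI [OF refl])?) (use 1 m k assms(3) in auto)
    next
      case 2
      show ?case
        unfolding 2(2) q d lead_monomials by (subst lead_odd_i2 [of k n, unfolded idx]; (rule conjI [OF refl])?) (use 2 m k assms(3) in auto)
    next
      case 3
      show ?case
        unfolding 3(2) q d lead_monomials by (subst lead_odd_i3 [of k n, unfolded idx]; (rule conjI [OF refl])?) (use 3 m k assms(3) in auto)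
    qed
    then have P: "P = \<iota> (lead_coeff (- m) (- m + n + 1) (- m + n + 2))" and le: "m \<le> 2 * n + 2"
      by blast+
    have A_mon: "A_mon (- m + 1) = yX 0 1 0" using 5(1) by (simp add: A_mon_def)
    show ?case
      unfolding P product_odd_int [OF assms(2,3) le] A_mon
      using assms(3) g_sum_expansion [of n] g_sum_expansion_shift [of "n - 1" 1] by simp
  next
    case (6 P)
    then obtain k where m: "m = 2 * k + 1" by (elim oddE)
    have k: "0 \<le> k" using \<open>0 \<le> m\<close> m by simp
    have idx: "2 * k + 1 = m"
      by (simp_all add: m)
    have q:
      "torus_q (of_int (14 * n - 5 * m - 11) / 4) = qh (7 * n - 5 * k - 8)"
      "torus_q (of_int (5 * m - 5) / 4) = qh (5 * k)"
      "torus_q (of_int (m + 3) / 4) = qh (k + 2)"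
      by (rule torus_q_of_even_quarter; simp add: m)+
    have d: "(2 * n - m - 1) div 2 = n - k - 1" "(m - 1) div 2 = k"
      by (simp_all add: m)
    have "P = \<iota> (lead_coeff (- m) (- m + 2 * (n div 2)) (- m + 2 * ((n + 1) div 2))) \<and> m + 1 \<le> 2 * n"
      using 6(2)
    proof (elim disjE conjE, goal_cases)
      case 1
      show ?case
        unfolding 1(3) q d lead_monomials by (subst lead_odd_ii1 [of k n, unfolded idx]; (rule conjI [OF refl])?) (use 1 m k assms(3) in auto)
    next
      case 2
      show ?case
        unfolding 2(2) q d lead_monomials by (subst lead_odd_ii2 [of k n, unfolded idx]; (rule conjI [OF refl])?) (use 2 m k assms(3) in auto)
    next
      case 3
      show ?case
        unfolding 3(2) q d lead_monomials by (subst lead_odd_ii3 [of k n, unfolded idx]; (rule conjI [OF refl])?) (use 3 m k assms(3) in auto)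
    qed
    then have P: "P = \<iota> (lead_coeff (- m) (- m + 2 * (n div 2)) (- m + 2 * ((n + 1) div 2)))" and le: "m + 1 \<le> 2 * n"
      by blast+
    have W_elem: "W_elem (- m + 1) = w_elem" using 6(1) by (simp add: W_elem_def)
    show ?case
      unfolding P product_even_int [OF assms(2,3) le] W_elem
      using assms(3) g_sum_expansion [of "n - 2"] by simp
  next
    case (7 P)
    then obtain k where m: "m = 2 * k" by (elim evenE)
    have k: "0 \<le> k" using \<open>0 \<le> m\<close> m by simp
    have idx: "n - 2 * k + 1 = - m + n + 1" "n - 2 * k + 2 = - m + n + 2" "2 * k = m"
      by (simp_all add: m)
    have q:
      "torus_q (of_int (14 * n - 5 * m + 12) / 4) = qh (7 * n - 5 * k + 6)"
      "torus_q (of_int (5 * m) / 4) = qh (5 * k)"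
      "torus_q (of_int (m + 2) / 4) = qh (k + 1)"
      by (rule torus_q_of_even_quarter; simp add: m)+
    have d: "(2 * n - m + 2) div 2 = n - k + 1" "m div 2 = k"
      by (simp_all add: m)
    have "P = \<iota> (lead_coeff (- m) (- m + n + 1) (- m + n + 2)) \<and> m \<le> 2 * n + 2"
      using 7(2)
    proof (elim disjE conjE, goal_cases)
      case 1
      show ?case
        unfolding 1(3) q d lead_monomials by (subst lead_even_i1 [of k n, unfolded idx]; (rule conjI [OF refl])?) (use 1 m k assms(3) in auto)
    next
      case 2
      show ?case
        unfolding 2(2) q d lead_monomials by (subst lead_even_i2 [of k n, unfolded idx]; (rule conjI [OF refl])?) (use 2 m k assms(3) in auto)
    next
      case 3
      show ?case
        unfolding 3(2) q d lead_monomials by (subst lead_even_i3 [of k n, unfolded idx]; (rule conjI [OF refl])?) (use 3 m k assms(3) in auto)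
    qed
    then have P: "P = \<iota> (lead_coeff (- m) (- m + n + 1) (- m + n + 2))" and le: "m \<le> 2 * n + 2"
      by blast+
    \<comment> \<open>Writing \<open>X^(e4+e6)\<close> as the ordered product of \<open>y_1\<close>
      and \<open>y_3\<close> costs one more factor h; together with the h of the product formula it
      gives the exponent \<open>(2i+2+3l)/2\<close>.\<close>
    have A_mon: "\<iota> (A_mon (- m + 1)) = \<iota> (qh 1) * (\<iota> (yX 1 0 0) * \<iota> (yX 0 0 1))"
      using 7(1) by (simp add: A_mon_def mult [symmetric] yX_mult qh_mult_left)
    have c: "qh 2 = qh 1 * qh 1" by (simp add: qh_mult)
    show ?case
      unfolding P product_odd_int [OF assms(2,3) le] A_mon
      using assms(3) g_sum_expansion [of n] g_sum_expansion_shift [of "n - 1" 2]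
      by (simp add: c mult mult.assoc qh_left_central [of "\<iota> (yX _ _ _)"])
  next
    case (8 P)
    then obtain k where m: "m = 2 * k" by (elim evenE)
    have k: "0 \<le> k" using \<open>0 \<le> m\<close> m by simp
    have idx: "2 * k = m"
      by (simp_all add: m)
    have q:
      "torus_q (of_int (14 * n - 5 * m - 14) / 4) = qh (7 * n - 5 * k - 7)"
      "torus_q (of_int (5 * m) / 4) = qh (5 * k)"
      "torus_q (of_int (m + 2) / 4) = qh (k + 1)"
      by (rule torus_q_of_even_quarter; simp add: m)+
    have d: "(2 * n - m - 2) div 2 = n - k - 1" "m div 2 = k"
      by (simp_all add: m)
    have "P = \<iota> (lead_coeff (- m) (- m + 2 * (n div 2)) (- m + 2 * ((n + 1) div 2))) \<and> m + 1 \<le> 2 * n"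
      using 8(2)
    proof (elim disjE conjE, goal_cases)
      case 1
      show ?case
        unfolding 1(3) q d lead_monomials by (subst lead_even_ii1 [of k n, unfolded idx]; (rule conjI [OF refl])?) (use 1 m k assms(3) in auto)
    next
      case 2
      show ?case
        unfolding 2(2) q d lead_monomials by (subst lead_even_ii2 [of k n, unfolded idx]; (rule conjI [OF refl])?) (use 2 m k assms(3) in auto)
    next
      case 3
      show ?case
        unfolding 3(2) q d lead_monomials by (subst lead_even_ii3 [of k n, unfolded idx]; (rule conjI [OF refl])?) (use 3 m k assms(3) in auto)
    qed
    then have P: "P = \<iota> (lead_coeff (- m) (- m + 2 * (n div 2)) (- m + 2 * ((n + 1) div 2)))" and le: "m + 1 \<le> 2 * n"
      by blast+
    have W_elem: "W_elem (- m + 1) = z_elem" using 8(1) by (simp add: W_elem_def)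
    show ?case
      unfolding P product_even_int [OF assms(2,3) le] W_elem
      using assms(3) g_sum_expansion [of "n - 2"] by simp
  qed
qed

end
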